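(* Consider a Bayesian multi-parameter unit-demand (BMUMD) setting with bidders $1,\dots,n$, a finite set $\mathcal U$ of services partitioned into disjoint sets $J_1,\dots,J_n$ (bidder $i$ is interested only in services of $J_i$), and a feasibility family $\mathcal I\subseteq 2^{\mathcal U}$ which is the intersection of $p\ge1$ matroids on $\mathcal U$ and such that every $S\in\mathcal I$ satisfies $|S\cap J_i|\le1$ for all $i$. The values $v_x$, $x\in\mathcal U$, are independent, each with a distribution $F_x$ having a positive density $f_x$ on its support interval and regular (the virtual valuation $\phi_x(v)=v-\frac{1-F_x(v)}{f_x(v)}$ is increasing). Then the mechanism $\mathcal{M}$ described below obtains expected revenue at least $\frac{1}{4p-2}$ times that of the optimal individually rational, truthful deterministic mechanism; in particular when $\mathcal I$ is a single matroid ($p=1$) it is a $2$-approximation. Mechanism $\mathcal M$: initialize $A=\emptyset$. For $i=1,\dots,n$: for each $x\in J_i$ set $p_x=\phi_x^{-1}(T(A,x))$ if $A\cup\{x\}\in\mathcal I$ and $p_x=\infty$ otherwise; post the price vector $(p_x)_{x\in J_i}$ to bidder $i$, who chooses at most one $x\in J_i$ at these prices (maximizing $v_x-p_x$, or nothing); if $x$ is chosen, allocate $x$ to bidder $i$, charge $p_x$, and set $A\gets A\cup\{x\}$; otherwise charge $0$.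
   Context: Bidder $i$ has quasilinear unit-demand utility: receiving service $x\in J_i$ at price $q$ gives utility $v_x-q$. Write $\mathcal I=\bigcap_{j=1}^p\mathcal I_j$ for matroids $(\mathcal U,\mathcal I_j)$ with closure operators $\mathrm{cl}_j$, and let $\alpha=2p$. Let $w'(y)$, $y\in\mathcal U$, be independent random variables with $w'(y)$ distributed as $\phi_y(v_y)$, $w'(S)=\sum_{y\in S}w'(y)$, and let $B\in\mathcal I$ maximize $w'(B)$. For $A\in\mathcal I$ and each $j$, let $(C_j(A),R_j(A))$ be, among partitions of $B$ into disjoint $C_j,R_j$ with $A\cup R_j\in\mathcal I_j$ and $B\subseteq\mathrm{cl}_j(A\cup R_j)$, one maximizing $w'(R_j)$. The threshold is $T(A,x)=\frac1\alpha\sum_{j=1}^p\mathbb{E}[w'(R_j(A))-w'(R_j(A\cup\{x\}))]$ (expectation over $w'$).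
   Formalization: The values are assumed to have finite mean (the claim fails for some infinite-mean regular distributions), and R_j(A) is required to be disjoint from A, elements of B counting as copies separate from A (with the plain union the claim fails already for a single item). *)

theory Defs
  imports "HOL-Probability.Probability"
begin

subsection \<open>Matroids on a finite ground set\<close>

definition matroid :: "'u set \<Rightarrow> 'u set set \<Rightarrow> bool" where
  "matroid U I \<longleftrightarrow>
     finite U \<and> I \<subseteq> Pow U \<and> {} \<in> I \<and>
     (\<forall>X Y. X \<in> I \<and> Y \<subseteq> X \<longrightarrow> Y \<in> I) \<and>
     (\<forall>X Y. X \<in> I \<and> Y \<in> I \<and> card X < card Y \<longrightarrow> (\<exists>y\<in>Y - X. insert y X \<in> I))"

definition matroid_rank :: "'u set set \<Rightarrow> 'u set \<Rightarrow> nat" where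
  "matroid_rank I S = Max (card ` {X \<in> I. X \<subseteq> S})"

definition matroid_cl :: "'u set \<Rightarrow> 'u set set \<Rightarrow> 'u set \<Rightarrow> 'u set" where
  "matroid_cl U I S = {x \<in> U. matroid_rank I (insert x S) = matroid_rank I S}"


subsection \<open>Value distributions\<close>

text \<open>A value distribution is given by its density \<^term>\<open>f :: real \<Rightarrow> real\<close>; the
  support interval is the set on which the density is positive.\<close>

definition val_dist :: "(real \<Rightarrow> real) \<Rightarrow> real measure" where
  "val_dist f = density lborel (\<lambda>t. ennreal (f t))"

definition val_supp :: "(real \<Rightarrow> real) \<Rightarrow> real set" where
  "val_supp f = {t. 0 < f t}"

definition virtual_value :: "(real \<Rightarrow> real) \<Rightarrow> real \<Rightarrow> real" where
  "virtual_value f t = t - (1 - cdf (val_dist f) t) / f t"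

text \<open>Besides the density and regularity, the mean is required to be finite, as is implicit
  in speaking of expected revenue and expected virtual values: for infinite means the identity
  between expected revenue and expected virtual surplus can fail.\<close>

definition regular_density :: "(real \<Rightarrow> real) \<Rightarrow> bool" where
  "regular_density f \<longleftrightarrow>
     f \<in> borel_measurable borel \<and> (\<forall>t. 0 \<le> f t) \<and> prob_space (val_dist f) \<and>
     is_interval (val_supp f) \<and> integrable (val_dist f) (\<lambda>t. t) \<and>
     mono_on (val_supp f) (virtual_value f)"

text \<open>The inverse of the virtual valuation. A target above all virtual values gives the price
  \<^term>\<open>\<infinity>\<close> (no sale); a target below all of them gives the left end of the support. Where
  \<^term>\<open>virtual_value f\<close> is strictly increasing and attains \<^term>\<open>t\<close>, this is the ordinary
  inverse.\<close>

definition virtual_inv :: "(real \<Rightarrow> real) \<Rightarrow> real \<Rightarrow> ereal" where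
  "virtual_inv f t = (INF v\<in>{v \<in> val_supp f. t \<le> virtual_value f v}. ereal v)"


subsection \<open>Bayesian multi-parameter unit-demand settings\<close>

record 'u bmumd =
  bidders :: nat
  services :: "'u set"
  interest :: "nat \<Rightarrow> 'u set"          \<comment> \<open>the sets \<open>J\<^sub>i\<close>\<close>
  num_mat :: nat                        \<comment> \<open>the number \<open>p\<close> of matroids\<close>
  indep :: "nat \<Rightarrow> 'u set set"         \<comment> \<open>the independent sets \<open>I\<^sub>j\<close>\<close>
  dens :: "'u \<Rightarrow> real \<Rightarrow> real"

definition feasible :: "'u bmumd \<Rightarrow> 'u set set" where
  "feasible E = (\<Inter>j\<in>{1..num_mat E}. indep E j)"

definition bmumd_setting :: "'u bmumd \<Rightarrow> bool" where
  "bmumd_setting E \<longleftrightarrow>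
     finite (services E) \<and>
     (\<Union>i\<in>{1..bidders E}. interest E i) = services E \<and>
     disjoint_family_on (interest E) {1..bidders E} \<and>
     1 \<le> num_mat E \<and>
     (\<forall>j\<in>{1..num_mat E}. matroid (services E) (indep E j)) \<and>
     (\<forall>S\<in>feasible E. \<forall>i\<in>{1..bidders E}. card (S \<inter> interest E i) \<le> 1) \<and>
     (\<forall>x\<in>services E. regular_density (dens E x))"

text \<open>Joint law of the (independent) values, and the profiles of values in the supports.\<close>

definition value_law :: "'u bmumd \<Rightarrow> ('u \<Rightarrow> real) measure" where
  "value_law E = Pi\<^sub>M (services E) (\<lambda>x. val_dist (dens E x))"

definition type_space :: "'u bmumd \<Rightarrow> ('u \<Rightarrow> real) set" where
  "type_space E = Pi\<^sub>E (services E) (\<lambda>x. val_supp (dens E x))"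


subsection \<open>Deterministic, individually rational, truthful mechanisms\<close>

text \<open>A deterministic direct mechanism maps a reported profile to the set of allocated services
  (bidder \<^term>\<open>i\<close> gets the at most one of them that lies in \<^term>\<open>interest E i\<close>) and to the
  payments of the bidders.\<close>

record 'u mechanism =
  alloc :: "('u \<Rightarrow> real) \<Rightarrow> 'u set"
  pay :: "('u \<Rightarrow> real) \<Rightarrow> nat \<Rightarrow> real"

definition mech_utility ::
    "'u bmumd \<Rightarrow> 'u mechanism \<Rightarrow> nat \<Rightarrow> ('u \<Rightarrow> real) \<Rightarrow> ('u \<Rightarrow> real) \<Rightarrow> real" where
  "mech_utility E M i v r = (\<Sum>x\<in>alloc M r \<inter> interest E i. v x) - pay M r i"

definition feasible_mechanism :: "'u bmumd \<Rightarrow> 'u mechanism \<Rightarrow> bool" where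
  "feasible_mechanism E M \<longleftrightarrow> (\<forall>v\<in>type_space E. alloc M v \<in> feasible E)"

definition individually_rational :: "'u bmumd \<Rightarrow> 'u mechanism \<Rightarrow> bool" where
  "individually_rational E M \<longleftrightarrow>
     (\<forall>v\<in>type_space E. \<forall>i\<in>{1..bidders E}. 0 \<le> mech_utility E M i v v)"

definition truthful :: "'u bmumd \<Rightarrow> 'u mechanism \<Rightarrow> bool" where
  "truthful E M \<longleftrightarrow>
     (\<forall>v\<in>type_space E. \<forall>i\<in>{1..bidders E}. \<forall>r\<in>type_space E.
        (\<forall>x\<in>services E - interest E i. r x = v x) \<longrightarrow>
        mech_utility E M i v r \<le> mech_utility E M i v v)"

definition mech_revenue :: "'u bmumd \<Rightarrow> 'u mechanism \<Rightarrow> real" where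
  "mech_revenue E M = (\<integral>v. (\<Sum>i=1..bidders E. pay M v i) \<partial>value_law E)"

text \<open>Under individual rationality the total payment is bounded above by an integrable function,
  so integrability only excludes mechanisms with expected revenue \<^term>\<open>-\<infinity>\<close>.\<close>

definition admissible_mechanisms :: "'u bmumd \<Rightarrow> 'u mechanism set" where
  "admissible_mechanisms E = {M.
     feasible_mechanism E M \<and> individually_rational E M \<and> truthful E M \<and>
     alloc M \<in> measurable (value_law E) (count_space UNIV) \<and>
     (\<forall>i\<in>{1..bidders E}. (\<lambda>v. pay M v i) \<in> borel_measurable (value_law E)) \<and>
     integrable (value_law E) (\<lambda>v. \<Sum>i=1..bidders E. pay M v i)}"

definition optimal_revenue :: "'u bmumd \<Rightarrow> ereal" where
  "optimal_revenue E = (SUP M\<in>admissible_mechanisms E. ereal (mech_revenue E M))"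


subsection \<open>Thresholds\<close>

text \<open>The random weights \<open>w'\<close> are the virtual values of a sample \<^term>\<open>s\<close> drawn from
  \<^term>\<open>value_law E\<close>, independently of the bidders' values.\<close>

definition weight :: "'u bmumd \<Rightarrow> ('u \<Rightarrow> real) \<Rightarrow> 'u \<Rightarrow> real" where
  "weight E s y = virtual_value (dens E y) (s y)"

text \<open>A selection of the maximum-weight feasible set \<open>B\<close>, with arbitrary (measurable)
  tie-breaking.\<close>

definition max_weight_selection :: "'u bmumd \<Rightarrow> (('u \<Rightarrow> real) \<Rightarrow> 'u set) \<Rightarrow> bool" where
  "max_weight_selection E B \<longleftrightarrow>
     B \<in> measurable (value_law E) (count_space UNIV) \<and>
     (\<forall>s\<in>space (value_law E). is_arg_max (sum (weight E s)) (\<lambda>S. S \<in> feasible E) (B s))"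

text \<open>The set \<open>B\<close> comes from an independent sample, so its elements count as copies distinct from
  (and parallel to) the elements of \<open>A\<close>: the union \<open>A \<union> R\<close> is a disjoint one, and an element of
  \<open>A \<inter> B\<close> always belongs to \<open>C\<close>. Without the condition \<open>A \<inter> R = {}\<close> such an element could be put
  in \<open>R\<close> for free; for one item the threshold would then be \<open>E[max w'; argmax \<noteq> x] / 2\<close> in place of
  \<open>E[max w'] / 2\<close>, which does not guarantee half of the optimum.\<close>

definition exchange_partition ::
    "'u bmumd \<Rightarrow> nat \<Rightarrow> 'u set \<Rightarrow> 'u set \<Rightarrow> 'u set \<times> 'u set \<Rightarrow> bool" where
  "exchange_partition E j A B = (\<lambda>(C, R).
     C \<union> R = B \<and> C \<inter> R = {} \<and> A \<inter> R = {} \<and> A \<union> R \<in> indep E j \<and>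
     B \<subseteq> matroid_cl (services E) (indep E j) (A \<union> R))"

definition best_partition ::
    "'u bmumd \<Rightarrow> ('u \<Rightarrow> real) \<Rightarrow> nat \<Rightarrow> 'u set \<Rightarrow> 'u set \<Rightarrow> 'u set \<times> 'u set" where
  "best_partition E w j B A = arg_max (\<lambda>(C, R). sum w R) (exchange_partition E j A B)"

definition rem_weight ::
    "'u bmumd \<Rightarrow> (('u \<Rightarrow> real) \<Rightarrow> 'u set) \<Rightarrow> nat \<Rightarrow> 'u set \<Rightarrow> ('u \<Rightarrow> real) \<Rightarrow> real" where
  "rem_weight E B j A s = sum (weight E s) (snd (best_partition E (weight E s) j (B s) A))"

definition threshold :: "'u bmumd \<Rightarrow> (('u \<Rightarrow> real) \<Rightarrow> 'u set) \<Rightarrow> 'u set \<Rightarrow> 'u \<Rightarrow> real" where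
  "threshold E B A x =
     1 / (2 * real (num_mat E)) *
     (\<Sum>j=1..num_mat E. \<integral>s. (rem_weight E B j A s - rem_weight E B j (insert x A) s) \<partial>value_law E)"


subsection \<open>The posted-price mechanism\<close>

definition posted_price :: "'u bmumd \<Rightarrow> (('u \<Rightarrow> real) \<Rightarrow> 'u set) \<Rightarrow> 'u set \<Rightarrow> 'u \<Rightarrow> ereal" where
  "posted_price E B A x =
     (if insert x A \<in> feasible E then virtual_inv (dens E x) (threshold E B A x) else \<infinity>)"

definition buyer_utility :: "('u \<Rightarrow> ereal) \<Rightarrow> ('u \<Rightarrow> real) \<Rightarrow> 'u option \<Rightarrow> ereal" where
  "buyer_utility q v c = (case c of None \<Rightarrow> 0 | Some x \<Rightarrow> ereal (v x) - q x)"

text \<open>A choice rule tells what bidder \<^term>\<open>i\<close> chooses when the services in \<^term>\<open>A\<close> have been sold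
  and the values are \<^term>\<open>v\<close>; ties are broken arbitrarily (but measurably).\<close>

definition choice_rule ::
    "'u bmumd \<Rightarrow> (('u \<Rightarrow> real) \<Rightarrow> 'u set) \<Rightarrow>
     (nat \<Rightarrow> 'u set \<Rightarrow> ('u \<Rightarrow> real) \<Rightarrow> 'u option) \<Rightarrow> bool" where
  "choice_rule E B ch \<longleftrightarrow>
     (\<forall>i\<in>{1..bidders E}. \<forall>A\<in>feasible E.
        ch i A \<in> measurable (value_law E) (count_space UNIV) \<and>
        (\<forall>v\<in>space (value_law E).
           is_arg_max (buyer_utility (posted_price E B A) v)
             (\<lambda>c. c \<in> insert None (Some ` interest E i)) (ch i A v)))"

text \<open>Services sold to the first \<^term>\<open>k\<close> bidders, and the payments collected from them.\<close>

primrec run ::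
    "'u bmumd \<Rightarrow> (('u \<Rightarrow> real) \<Rightarrow> 'u set) \<Rightarrow>
     (nat \<Rightarrow> 'u set \<Rightarrow> ('u \<Rightarrow> real) \<Rightarrow> 'u option) \<Rightarrow>
     ('u \<Rightarrow> real) \<Rightarrow> nat \<Rightarrow> 'u set \<times> real" where
  "run E B ch v 0 = ({}, 0)"
| "run E B ch v (Suc k) =
     (let (A, r) = run E B ch v k in
      case ch (Suc k) A v of
        None \<Rightarrow> (A, r)
      | Some x \<Rightarrow> (insert x A, r + real_of_ereal (posted_price E B A x)))"

definition posted_revenue ::
    "'u bmumd \<Rightarrow> (('u \<Rightarrow> real) \<Rightarrow> 'u set) \<Rightarrow>
     (nat \<Rightarrow> 'u set \<Rightarrow> ('u \<Rightarrow> real) \<Rightarrow> 'u option) \<Rightarrow> real" where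
  "posted_revenue E B ch = (\<integral>v. snd (run E B ch v (bidders E)) \<partial>value_law E)"

end

theory Submission
  imports Defs
begin

text \<open>
  Every truthful mechanism is dominated by the single-parameter optimum: for fixed other values the
  set of values at which a service \<open>x\<close> is allocated is up-closed and its price there is constant, so
  Myerson's identity bounds the revenue from \<open>x\<close> by its expected positive virtual value, and
  summing over \<open>x\<close> gives at most \<open>W = \<bbbE>[w'(B)]\<close>.

  Conversely, let \<open>c(A) = \<Sum>\<^sub>j \<bbbE>[w'(C\<^sub>j(A))]\<close> and let \<open>A\<close> be the set sold. The thresholds of the sold
  services telescope to \<open>c(A) / 2p\<close>. Submodularity of \<open>A \<mapsto> w'(R\<^sub>j(A))\<close> makes the thresholds increase
  along the run and bounds the sum of the thresholds over \<open>R(A) = \<Inter>\<^sub>j R\<^sub>j(A)\<close> by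
  \<open>(pW - c(A)) / 2p\<close>, while \<open>w'(R(A)) \<ge> w'(B) - \<Sum>\<^sub>j w'(C\<^sub>j(A))\<close>. A service whose bidder buys
  nothing would have been sold, had its value exceeded its price, so the revenue in excess of the
  thresholds is at least \<open>W/2 - \<bbbE>[c(A)] (1 - 1/2p)\<close>. Averaging the two lower bounds
  \<open>\<bbbE>[c(A)] / 2p\<close> and \<open>\<bbbE>[c(A)] / 2p + W/2 - \<bbbE>[c(A)] (1 - 1/2p)\<close> on the revenue with weights
  \<open>(2p - 2) / (2p - 1)\<close> and \<open>1 / (2p - 1)\<close> eliminates \<open>\<bbbE>[c(A)]\<close> and leaves \<open>W / (4p - 2)\<close>.
\<close>

section \<open>Matroid contractions\<close>

lemma matroid_finite: "matroid U I \<Longrightarrow> X \<in> I \<Longrightarrow> finite X"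
  by (auto simp: matroid_def intro: finite_subset)

lemma matroid_subset:
  assumes "matroid U I" "X \<in> I" "Y \<subseteq> X" shows "Y \<in> I"
proof -
  have "\<forall>X Y. X \<in> I \<and> Y \<subseteq> X \<longrightarrow> Y \<in> I" using assms(1) unfolding matroid_def by (elim conjE)
  then show ?thesis using assms(2,3) by blast
qed

lemma matroid_augment:
  assumes "matroid U I" "X \<in> I" "Y \<in> I" "card X < card Y"
  obtains y where "y \<in> Y" "y \<notin> X" "insert y X \<in> I"
proof -
  have "\<forall>X Y. X \<in> I \<and> Y \<in> I \<and> card X < card Y \<longrightarrow> (\<exists>y\<in>Y - X. insert y X \<in> I)"
    using assms(1) unfolding matroid_def by (elim conjE)
  then have "\<exists>y\<in>Y - X. insert y X \<in> I" using assms(2-4) by blast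
  then show thesis using that by blast
qed

text \<open>Repeated augmentation: each step adds an element of \<open>Y\<close> to
  \<open>X\<close>, until the cardinality of \<open>Y\<close> is reached.\<close>

lemma matroid_extend:
  assumes "matroid U I" "X \<in> I" "Y \<in> I" "card X \<le> card Y"
  shows "\<exists>Z. X \<subseteq> Z \<and> Z \<subseteq> X \<union> Y \<and> Z \<in> I \<and> card Z = card Y"
  using assms(2,4)
proof (induction "card Y - card X" arbitrary: X)
  case 0
  then have "card X = card Y" by simp
  then show ?case using 0(2) by (intro exI[of _ X] conjI) auto
next
  case (Suc n)
  then have "card X < card Y" by simp
  then obtain y where y: "y \<in> Y" "y \<notin> X" "insert y X \<in> I"
    by (rule matroid_augment[OF assms(1) Suc.prems(1) assms(3)])
  have "card (insert y X) = Suc (card X)"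
    using y(2) matroid_finite[OF assms(1) Suc.prems(1)] by simp
  then have "n = card Y - card (insert y X)" "card (insert y X) \<le> card Y"
    using Suc.hyps(2) by simp_all
  from Suc.hyps(1)[OF this(1) y(3) this(2)]
  obtain Z where Z: "insert y X \<subseteq> Z" "Z \<subseteq> insert y X \<union> Y" "Z \<in> I" "card Z = card Y"
    by blast
  show ?case
    by (rule exI[of _ Z], intro conjI) (use Z y in auto)
qed

text \<open>A counting argument: the elements of \<open>R\<close> that cannot be added to
  \<open>K\<close> leave room for \<open>x\<close>, because \<open>x\<close> itself can be added to
  \<open>K\<close>. Completing them, together with \<open>A\<close> and \<open>x\<close>, from
  \<open>A \<union> R\<close> gives up exactly one element, which then has to be addable to
  \<open>K\<close>.\<close>

lemma matroid_symmetric_exchange: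
  assumes M: "matroid U I" and AR: "A \<union> R \<in> I" and K: "A \<subseteq> K" "insert x K \<in> I" "x \<notin> K"
    and x: "x \<notin> A \<union> R" "insert x (A \<union> R) \<notin> I"
  obtains z where "z \<in> R" "z \<notin> K" "insert x (A \<union> R - {z}) \<in> I" "insert z K \<in> I"
proof -
  \<comment> \<open>The elements of \<open>R\<close> that are unsuitable as
    \<open>z\<close>.\<close>
  define D where "D = {z \<in> R. z \<in> K \<or> insert z K \<notin> I}"
  have KI: "K \<in> I" by (rule matroid_subset[OF M K(2)]) auto
  have finK: "finite K" by (rule matroid_finite[OF M KI])
  have AD: "A \<union> D \<in> I" by (rule matroid_subset[OF M AR]) (auto simp: D_def)
  \<comment> \<open>\<open>K\<close> is a largest independent subset of \<open>K \<union> D\<close>,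
    since no element of \<open>D\<close> augments it.\<close>
  have no_aug: False if Y: "Y \<in> I" "Y \<subseteq> K \<union> D" "card K < card Y" for Y
  proof -
    obtain z where "z \<in> Y" "z \<notin> K" "insert z K \<in> I" by (rule matroid_augment[OF M KI Y(1,3)])
    then show False using Y(2) by (auto simp: D_def)
  qed
  \<comment> \<open>Otherwise \<open>A \<union> D\<close> extends by elements of
    \<open>insert x K\<close> to size \<open>card K + 1\<close> without using \<open>x\<close>, that
    is inside \<open>K \<union> D\<close>, against \<open>no_aug\<close>.\<close>
  have ADx: "insert x (A \<union> D) \<in> I"
  proof (rule ccontr)
    assume n: "insert x (A \<union> D) \<notin> I"
    have "card (A \<union> D) \<le> card K" using no_aug[OF AD] K(1) by (force simp: not_less)
    then obtain Z where Z: "A \<union> D \<subseteq> Z" "Z \<subseteq> (A \<union> D) \<union> insert x K" "Z \<in> I" "card Z = Suc (card K)"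
      using matroid_extend[OF M AD K(2)] K(3) finK by auto
    have "x \<notin> Z" using n Z(1) matroid_subset[OF M Z(3), of "insert x (A \<union> D)"] by blast
    then have "Z \<subseteq> K \<union> D" using Z(2) K(1) by auto
    then show False using no_aug[OF Z(3)] Z(4) by simp
  qed
  have finAR: "finite (A \<union> R)" by (rule matroid_finite[OF M AR])
  have "A \<union> D \<noteq> A \<union> R" using ADx x(2) by metis
  then have "A \<union> D \<subset> A \<union> R" unfolding D_def by blast
  then have "card (A \<union> D) < card (A \<union> R)" by (rule psubset_card_mono[OF finAR])
  moreover have "x \<notin> A \<union> D" using x(1) by (auto simp: D_def)
  ultimately have "card (insert x (A \<union> D)) \<le> card (A \<union> R)"
    using matroid_finite[OF M AD] by simp
  \<comment> \<open>\<open>Z\<close> has as many elements as \<open>A \<union> R\<close>, contains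
    \<open>x\<close> and lies in \<open>insert x (A \<union> R)\<close>, so it misses exactly one
    \<open>z\<close>; as \<open>D\<close> is inside \<open>Z\<close>, this \<open>z\<close> is
    suitable.\<close>
  from matroid_extend[OF M ADx AR this]
  obtain Z where Z: "insert x (A \<union> D) \<subseteq> Z" "Z \<subseteq> insert x (A \<union> D) \<union> (A \<union> R)" "Z \<in> I"
      "card Z = card (A \<union> R)"
    by blast
  have finZ: "finite Z" by (rule matroid_finite[OF M Z(3)])
  have sub: "Z - {x} \<subseteq> A \<union> R" using Z(2) unfolding D_def by blast
  have xZ: "x \<in> Z" using Z(1) by blast
  then have "0 < card Z" using finZ card_gt_0_iff by blast
  moreover have "card ((A \<union> R) - (Z - {x})) = card (A \<union> R) - card (Z - {x})"
    using finZ by (intro card_Diff_subset sub) simp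
  ultimately have "card ((A \<union> R) - (Z - {x})) = 1"
    using xZ finZ Z(4) by (simp add: card_Diff_singleton)
  then obtain z where z: "(A \<union> R) - (Z - {x}) = {z}" by (auto simp: card_1_singleton_iff)
  have "z \<in> A \<union> R" "z \<notin> Z - {x}" using z by blast+
  moreover from this have "z \<noteq> x" using x(1) by blast
  ultimately have "z \<notin> Z" by blast
  then have "z \<in> R" "z \<notin> D" using Z(1) \<open>z \<in> A \<union> R\<close> by blast+
  moreover have "insert x (A \<union> R - {z}) \<in> I"
  proof (rule matroid_subset[OF M Z(3)])
    show "insert x (A \<union> R - {z}) \<subseteq> Z" using z xZ by blast
  qed
  ultimately show thesis using that[of z] by (auto simp: D_def)
qed

text \<open>For \<open>A\<close> in \<open>I\<close> these are the independent subsets of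
  \<open>B\<close> in the contraction by \<open>A\<close>, where the elements of \<open>A\<close>
  themselves count as loops.\<close>

definition residual_sets :: "'u set set \<Rightarrow> 'u set \<Rightarrow> 'u set \<Rightarrow> 'u set set" where
  "residual_sets I B A = {R. R \<subseteq> B \<and> A \<inter> R = {} \<and> A \<union> R \<in> I}"

text \<open>The largest weight \<open>w(R)\<close> over exchange partitions \<open>(C, R)\<close> of \<open>B\<close>: for nonnegative weights
  the spanning condition can be dropped.\<close>

definition residual_weight :: "'u set set \<Rightarrow> ('u \<Rightarrow> real) \<Rightarrow> 'u set \<Rightarrow> 'u set \<Rightarrow> real" where
  "residual_weight I w B A = Max (sum w ` residual_sets I B A)"

section \<open>Bounds and submodularity of the residual weight\<close>

lemma finite_residual_sets: "finite B \<Longrightarrow> finite (residual_sets I B A)"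
  unfolding residual_sets_def by (rule finite_subset[of _ "Pow B"]) auto

lemma empty_residual_sets: "A \<in> I \<Longrightarrow> {} \<in> residual_sets I B A"
  by (auto simp: residual_sets_def)

lemma residual_weight_ge:
  "finite B \<Longrightarrow> R \<in> residual_sets I B A \<Longrightarrow> sum w R \<le> residual_weight I w B A"
  unfolding residual_weight_def by (intro Max_ge finite_imageI finite_residual_sets) auto

lemma residual_weight_attained:
  assumes "finite B" "A \<in> I"
  obtains R where "R \<in> residual_sets I B A" "residual_weight I w B A = sum w R"
proof -
  have "residual_weight I w B A \<in> sum w ` residual_sets I B A"
    unfolding residual_weight_def using empty_residual_sets[OF assms(2)]
    by (intro Max_in finite_imageI finite_residual_sets assms) auto
  then show thesis using that by auto
qed

lemma residual_weight_nonneg: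
  assumes "finite B" "A \<in> I" shows "0 \<le> residual_weight I w B A"
  using residual_weight_ge[OF assms(1) empty_residual_sets[OF assms(2)], of w] by simp

lemma residual_weight_le:
  assumes "finite B" "A \<in> I" "\<And>y. y \<in> B \<Longrightarrow> 0 \<le> w y"
  shows "residual_weight I w B A \<le> sum w B"
proof -
  obtain R where "R \<in> residual_sets I B A" "residual_weight I w B A = sum w R"
    by (rule residual_weight_attained[OF assms(1,2)])
  then show ?thesis using assms by (auto simp: residual_sets_def intro!: sum_mono2)
qed

lemma residual_weight_empty:
  assumes "finite B" "B \<in> I" "{} \<in> I" "\<And>y. y \<in> B \<Longrightarrow> 0 \<le> w y"
  shows "residual_weight I w B {} = sum w B"
  proof (rule antisym)
  show "residual_weight I w B {} \<le> sum w B" by (rule residual_weight_le[OF assms(1,3,4)])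
  show "sum w B \<le> residual_weight I w B {}"
    using assms(2) by (intro residual_weight_ge assms(1)) (simp add: residual_sets_def)
qed

text \<open>Given optimal residual sets \<open>R\<close> for \<open>A\<close> and \<open>Q\<close> for \<open>A \<union> {x, y}\<close>, move one element from \<open>R\<close> to
  \<open>Q\<close> (or none) so that \<open>R\<close> becomes compatible with \<open>x\<close> and \<open>Q\<close> with \<open>A \<union> {y}\<close>. The element is a copy of
  \<open>x\<close> if \<open>x \<in> R\<close>.\<close>

lemma residual_weight_submodular:
  assumes M: "matroid U I" and fin: "finite B" and I: "insert x (insert y A) \<in> I"
    and xy: "x \<noteq> y" "x \<notin> A" "y \<notin> A"
  shows "residual_weight I w B A + residual_weight I w B (insert x (insert y A))
      \<le> residual_weight I w B (insert x A) + residual_weight I w B (insert y A)"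
proof -
  have AI: "A \<in> I" by (rule matroid_subset[OF M I]) auto
  obtain R where R: "R \<in> residual_sets I B A" "residual_weight I w B A = sum w R"
    by (rule residual_weight_attained[OF fin AI])
  obtain Q where Q: "Q \<in> residual_sets I B (insert x (insert y A))"
      "residual_weight I w B (insert x (insert y A)) = sum w Q"
    by (rule residual_weight_attained[OF fin I])
  have R': "R \<subseteq> B" "A \<inter> R = {}" "A \<union> R \<in> I" and Q': "Q \<subseteq> B" "insert x (insert y A) \<inter> Q = {}"
      "insert x (insert y A) \<union> Q \<in> I"
    using R(1) Q(1) by (auto simp: residual_sets_def)
  have fQR: "finite Q" "finite R" using Q'(1) R'(1) fin finite_subset by auto
  have "\<exists>P1 \<in> residual_sets I B (insert x A). \<exists>P2 \<in> residual_sets I B (insert y A).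
      sum w P1 + sum w P2 = sum w R + sum w Q"
  proof (cases "x \<in> R")
    case True
    have "insert x (A \<union> (R - {x})) = A \<union> R" using True by auto
    then have "R - {x} \<in> residual_sets I B (insert x A)"
      using R' True by (auto simp: residual_sets_def insert_absorb)
    moreover have "insert x Q \<in> residual_sets I B (insert y A)"
      using R' Q' True xy by (auto simp: residual_sets_def insert_commute)
    moreover have "sum w (R - {x}) + sum w (insert x Q) = sum w R + sum w Q"
      using True Q'(2) fQR by (simp add: sum.remove[of R x])
    ultimately show ?thesis by blast
  next
    case False
    show ?thesis
    proof (cases "insert x (A \<union> R) \<in> I")
      case True
      then have "R \<in> residual_sets I B (insert x A)"
        using R' False by (auto simp: residual_sets_def)
      moreover have "Q \<in> residual_sets I B (insert y A)"
        using Q' matroid_subset[OF M Q'(3), of "insert y A \<union> Q"] by (auto simp: residual_sets_def)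
      ultimately show ?thesis by blast
    next
      case nI: False
      \<comment> \<open>\<open>x\<close> cannot be added to \<open>A \<union> R\<close> but can be
        added to \<open>K\<close>, which is the situation of the symmetric exchange; it supplies the
        element to move.\<close>
      define K where "K = insert y (A \<union> Q)"
      have K: "A \<subseteq> K" "insert x K \<in> I" "x \<notin> K" "x \<notin> A \<union> R"
        using Q' xy False by (auto simp: K_def insert_commute)
      obtain z where z: "z \<in> R" "z \<notin> K" "insert x (A \<union> R - {z}) \<in> I" "insert z K \<in> I"
        by (rule matroid_symmetric_exchange[OF M R'(3) K nI])
      have "insert x A \<union> (R - {z}) = insert x (A \<union> R - {z})" using z R' by auto
      then have "R - {z} \<in> residual_sets I B (insert x A)"
        using R' False z by (auto simp: residual_sets_def)
      moreover have "insert z Q \<in> residual_sets I B (insert y A)"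
        using R' Q' z by (auto simp: residual_sets_def K_def insert_commute)
      moreover have "sum w (R - {z}) + sum w (insert z Q) = sum w R + sum w Q"
        using z fQR by (simp add: sum.remove[of R z] K_def)
      ultimately show ?thesis by blast
    qed
  qed
  then obtain P1 P2 where P: "P1 \<in> residual_sets I B (insert x A)"
      "P2 \<in> residual_sets I B (insert y A)" "sum w P1 + sum w P2 = sum w R + sum w Q"
    by blast
  show ?thesis
    using residual_weight_ge[OF fin P(1), of w] residual_weight_ge[OF fin P(2), of w] R(2) Q(2) P(3)
    by linarith
qed

text \<open>The elements of \<open>A'\<close> outside \<open>A\<close> are added one at a time; each
  addition is one instance of submodularity.\<close>

lemma residual_weight_decrement_mono:
  assumes M: "matroid U I" and fin: "finite B" and I: "insert x A' \<in> I"
    and A: "A \<subseteq> A'" "x \<notin> A'"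
  shows "residual_weight I w B A - residual_weight I w B (insert x A)
      \<le> residual_weight I w B A' - residual_weight I w B (insert x A')"
proof -
  have *: "residual_weight I w B A - residual_weight I w B (insert x A)
      \<le> residual_weight I w B (A \<union> D) - residual_weight I w B (insert x (A \<union> D))"
    if "finite D" "insert x (A \<union> D) \<in> I" "x \<notin> A \<union> D" "A \<inter> D = {}" for D
    using that
  proof (induction D)
    case empty
    then show ?case by simp
  next
    case (insert y D)
    have "insert x (A \<union> D) \<in> I" by (rule matroid_subset[OF M insert.prems(1)]) auto
    moreover have "insert x (insert y (A \<union> D)) \<in> I" using insert.prems(1) by simp
    ultimately show ?case
      using insert.IH residual_weight_submodular[OF M fin, of x y "A \<union> D" w] insert.prems insert.hyps
      by auto
  qed
  have "finite (A' - A)" using matroid_finite[OF M I] by simp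
  from *[OF this] show ?thesis using A I by (auto simp: Un_absorb1)
qed

text \<open>Order \<open>V\<close>: the decrement of an element at \<open>A\<close> is at most its
  decrement after the earlier elements were added. Those decrements telescope, and the residual
  weight of \<open>A \<union> V\<close> is nonnegative.\<close>

lemma residual_weight_decrement_sum:
  assumes M: "matroid U I" and fin: "finite B" and I: "A \<union> V \<in> I" and V: "A \<inter> V = {}"
  shows "(\<Sum>x\<in>V. residual_weight I w B A - residual_weight I w B (insert x A))
      \<le> residual_weight I w B A"
proof -
  have "(\<Sum>x\<in>V. residual_weight I w B A - residual_weight I w B (insert x A))
      \<le> residual_weight I w B A - residual_weight I w B (A \<union> V)"
    if "finite V" using that I V
  proof (induction V)
    case empty
    then show ?case by simp
  next
    case (insert y V)
    have "A \<union> V \<in> I" by (rule matroid_subset[OF M insert.prems(1)]) auto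
    then show ?case
      using insert residual_weight_decrement_mono[OF M fin, of y "A \<union> V" A w] by simp
  qed
  moreover have "finite V" using matroid_finite[OF M I] by auto
  moreover have "0 \<le> residual_weight I w B (A \<union> V)" by (rule residual_weight_nonneg[OF fin I])
  ultimately show ?thesis by linarith
qed

section \<open>Rank, closure and finite maximization\<close>

lemma matroid_rank_indep:
  assumes M: "matroid U I" and "X \<in> I"
  shows "matroid_rank I X = card X"
proof -
  have "finite {Y \<in> I. Y \<subseteq> X}" using matroid_finite[OF M assms(2)] by auto
  then show ?thesis unfolding matroid_rank_def using assms(2) matroid_finite[OF M assms(2)]
    by (intro Max_eqI) (auto intro: card_mono)
qed

text \<open>A larger independent subset of \<open>insert b X\<close> would augment \<open>X\<close>,
  and only by \<open>b\<close>. This turns inclusion-maximality of a residual set into the spanning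
  condition of an exchange partition.\<close>

lemma matroid_cl_maximal:
  assumes M: "matroid U I" and X: "X \<in> I" and b: "b \<in> U" "b \<in> X \<or> insert b X \<notin> I"
  shows "b \<in> matroid_cl U I X"
proof (cases "b \<in> X")
  case True
  then show ?thesis using b by (simp add: matroid_cl_def insert_absorb)
next
  case False
  have finX: "finite X" by (rule matroid_finite[OF M X])
  have "card Y \<le> card X" if Y: "Y \<in> I" "Y \<subseteq> insert b X" for Y
  proof (rule ccontr)
    assume "\<not> card Y \<le> card X"
    then obtain y where "y \<in> Y" "y \<notin> X" "insert y X \<in> I"
      using matroid_augment[OF M X Y(1)] by auto
    then show False using Y(2) b False by auto
  qed
  note * = this
  have fin: "finite {Y \<in> I. Y \<subseteq> insert b X}"
    by (rule finite_subset[of _ "Pow (insert b X)"]) (use finX in auto)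
  have "Max (card ` {Y \<in> I. Y \<subseteq> insert b X}) = card X"
  proof (rule Max_eqI)
    show "finite (card ` {Y \<in> I. Y \<subseteq> insert b X})" using fin by (rule finite_imageI)
    show "n \<le> card X" if "n \<in> card ` {Y \<in> I. Y \<subseteq> insert b X}" for n
      using that * by blast
    show "card X \<in> card ` {Y \<in> I. Y \<subseteq> insert b X}" using X by blast
  qed
  then show ?thesis
    unfolding matroid_cl_def matroid_rank_indep[OF M X] using b(1)
    by (simp add: matroid_rank_def[of I "insert b X"])
qed

text \<open>\<open>arg_max\<close> is defined by choice and says nothing unless a maximizer exists;
  finiteness supplies one.\<close>

lemma arg_max_finite:
  fixes f :: "'a \<Rightarrow> real"
  assumes "finite {a. P a}" "P a0"
  shows "P (arg_max f P)" "\<And>a. P a \<Longrightarrow> f a \<le> f (arg_max f P)"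
proof -
  obtain m where "P m" "f m = Max (f ` {a. P a})"
  proof -
    have "Max (f ` {a. P a}) \<in> f ` {a. P a}" using assms by (intro Max_in) auto
    then show thesis using that by auto
  qed
  then have "is_arg_max f P m"
    using assms by (auto simp: is_arg_max_linorder)
  then have "is_arg_max f P (arg_max f P)"
    unfolding arg_max_def by (rule someI)
  then have *: "P (arg_max f P) \<and> (\<forall>a. P a \<longrightarrow> f a \<le> f (arg_max f P))"
    unfolding is_arg_max_linorder .
  show "P (arg_max f P)" by (rule conjunct1[OF *])
  show "f a \<le> f (arg_max f P)" if "P a" for a
    by (rule mp[OF spec[OF conjunct2[OF *]] that])
qed

section \<open>Virtual values of regular distributions\<close>

lemma space_val_dist [simp]: "space (val_dist f) = UNIV"
  by (simp add: val_dist_def)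

lemma sets_val_dist [simp, measurable_cong]: "sets (val_dist f) = sets borel"
  by (simp add: val_dist_def)

section \<open>A single regular value distribution\<close>

locale regular_dist =
  fixes f :: "real \<Rightarrow> real"
  assumes regular: "regular_density f"
begin

abbreviation "\<mu> \<equiv> val_dist f"
abbreviation "\<phi> \<equiv> virtual_value f"

lemma meas_f [measurable]: "f \<in> borel_measurable borel"
  and f_nonneg: "0 \<le> f t"
  and supp_interval: "is_interval (val_supp f)"
  and integrable_id [simp]: "integrable \<mu> (\<lambda>t. t)"
  and mono_virtual: "mono_on (val_supp f) \<phi>"
  using regular by (auto simp: regular_density_def)

sublocale real_distribution \<mu>
  using regular
  by (simp add: regular_density_def real_distribution_def real_distribution_axioms_def)

lemma has_bochner_integral_val_dist:
  fixes g :: "real \<Rightarrow> real"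
  assumes [measurable]: "g \<in> borel_measurable borel"
  shows "has_bochner_integral \<mu> g c \<longleftrightarrow> has_bochner_integral lborel (\<lambda>t. f t * g t) c"
proof -
  have "integrable \<mu> g \<longleftrightarrow> integrable lborel (\<lambda>t. f t * g t)"
    unfolding val_dist_def by (intro integrable_real_density) (auto simp: f_nonneg)
  moreover have "integral\<^sup>L \<mu> g = (\<integral>t. f t * g t \<partial>lborel)"
    unfolding val_dist_def by (intro integral_real_density) (auto simp: f_nonneg)
  ultimately show ?thesis by (simp add: has_bochner_integral_iff)
qed

lemma integrable_ind [simp]: "A \<in> sets borel \<Longrightarrow> integrable \<mu> (indicat_real A)"
  by (rule integrable_real_indicator) (auto simp: emeasure_eq_measure)

lemma AE_supp: "AE t in \<mu>. 0 < f t"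
  unfolding val_dist_def by (subst AE_density) auto

lemma AE_neq: "AE t in \<mu>. t \<noteq> c"
  unfolding val_dist_def using AE_lborel_singleton[of c] by (subst AE_density) auto

lemma measurable_cdf [measurable]: "cdf \<mu> \<in> borel_measurable borel"
  by (rule borel_measurable_mono) (auto intro: monoI cdf_nondecreasing)

lemma measurable_virtual [measurable]: "\<phi> \<in> borel_measurable borel"
  unfolding virtual_value_def by measurable

text \<open>The subtracted quotient is nonnegative everywhere; off the support, division by zero
  makes it 0.\<close>

lemma virtual_le: "\<phi> t \<le> t"
  using cdf_bounded_prob[of t] f_nonneg[of t] by (simp add: virtual_value_def)

lemma integrable_pos_part: "integrable \<mu> (\<lambda>t. max 0 (\<phi> t - c))"
proof (rule Bochner_Integration.integrable_bound)
  show "integrable \<mu> (\<lambda>t. \<bar>t\<bar> + \<bar>c\<bar>)" by auto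
  show "AE t in \<mu>. norm (max 0 (\<phi> t - c)) \<le> norm (\<bar>t\<bar> + \<bar>c\<bar>)"
  proof (rule AE_I2)
    fix t show "norm (max 0 (\<phi> t - c)) \<le> norm (\<bar>t\<bar> + \<bar>c\<bar>)" using virtual_le[of t] by auto
  qed
qed auto

lemma tail_eq: "1 - cdf \<mu> t = prob {t<..}"
proof -
  have "prob (space \<mu> - {..t}) = 1 - prob {..t}" by (rule prob_compl) auto
  then show ?thesis by (simp add: cdf_def Compl_eq_Diff_UNIV[symmetric])
qed

text \<open>By Fubini, both sides are the measure of the region \<open>m < t < u\<close> under
  Lebesgue measure in \<open>t\<close> and \<mu> in \<open>u\<close>.\<close>

lemma integral_tail:
  "has_bochner_integral lborel (\<lambda>t. (1 - cdf \<mu> t) * indicator {m<..} t) (\<integral>u. max 0 (u - m) \<partial>\<mu>)"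
proof (rule has_bochner_integral_nn_integral)
  interpret pair_sigma_finite lborel \<mu> ..
  have int: "integrable \<mu> (\<lambda>u. max 0 (u - m))" by auto
  have "(\<integral>\<^sup>+ t. ennreal ((1 - cdf \<mu> t) * indicator {m<..} t) \<partial>lborel)
      = (\<integral>\<^sup>+ t. (\<integral>\<^sup>+ u. indicator {m<..<u} t \<partial>\<mu>) \<partial>lborel)"
  proof (rule nn_integral_cong)
    fix t :: real
    have "(\<integral>\<^sup>+ u. indicator {m<..<u} t \<partial>\<mu>) = (\<integral>\<^sup>+ u. indicator {m<..} t * indicator {t<..} u \<partial>\<mu>)"
      by (intro nn_integral_cong) (auto split: split_indicator)
    also have "\<dots> = indicator {m<..} t * emeasure \<mu> {t<..}"
      by (simp add: nn_integral_cmult)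
    also have "\<dots> = ennreal ((1 - cdf \<mu> t) * indicator {m<..} t)"
      unfolding tail_eq emeasure_eq_measure by (auto split: split_indicator)
    finally show "ennreal ((1 - cdf \<mu> t) * indicator {m<..} t) = (\<integral>\<^sup>+ u. indicator {m<..<u} t \<partial>\<mu>)" ..
  qed
  also have "\<dots> = (\<integral>\<^sup>+ u. (\<integral>\<^sup>+ t. indicator {m<..<u} t \<partial>lborel) \<partial>\<mu>)"
  proof (rule Fubini'[symmetric])
    have "(\<lambda>(t, u). indicator {m<..<u} t :: ennreal)
        = (\<lambda>(t, u). indicator {x :: real \<times> real. m < fst x \<and> fst x < snd x} (t, u))"
      by (auto simp: fun_eq_iff split: split_indicator)
    also have "\<dots> \<in> borel_measurable (lborel \<Otimes>\<^sub>M \<mu>)" by measurable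
    finally show "(\<lambda>(t, u). indicator {m<..<u} t :: ennreal) \<in> borel_measurable (lborel \<Otimes>\<^sub>M \<mu>)" .
  qed
  also have "\<dots> = (\<integral>\<^sup>+ u. ennreal (max 0 (u - m)) \<partial>\<mu>)"
    by (intro nn_integral_cong) (auto simp: max_def)
  also have "\<dots> = ennreal (\<integral>u. max 0 (u - m) \<partial>\<mu>)"
    using int by (intro nn_integral_eq_integral) auto
  finally show "(\<integral>\<^sup>+ t. ennreal ((1 - cdf \<mu> t) * indicator {m<..} t) \<partial>lborel)
      = ennreal (\<integral>u. max 0 (u - m) \<partial>\<mu>)" .
qed (auto simp: cdf_bounded_prob)

text \<open>Myerson's identity for the posted price \<open>m\<close>: multiplied by the density, the
  virtual value is \<open>t * f t\<close> minus the tail, and the tail integrates to the mean of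
  \<open>max 0 (u - m)\<close>. The hypothesis covers the points where \<open>f\<close> vanishes, at
  which the tail must vanish as well.\<close>

lemma integral_virtual_above:
  assumes "\<And>t. m < t \<Longrightarrow> f t = 0 \<Longrightarrow> cdf \<mu> t = 1"
  shows "has_bochner_integral \<mu> (\<lambda>t. \<phi> t * indicator {m<..} t) (m * prob {m<..})"
proof -
  let ?I = "\<lambda>t. indicator {m<..} t :: real"
  have int: "integrable \<mu> (\<lambda>t. t * ?I t)"
    by (rule integrable_real_mult_indicator) auto
  have "has_bochner_integral lborel (\<lambda>t. f t * (t * ?I t)) (\<integral>t. t * ?I t \<partial>\<mu>)"
    using has_bochner_integral_integrable[OF int]
    by (subst (asm) has_bochner_integral_val_dist) auto
  from has_bochner_integral_diff[OF this integral_tail[of m]]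
  have "has_bochner_integral lborel (\<lambda>t. f t * (t * ?I t) - (1 - cdf \<mu> t) * ?I t)
      ((\<integral>t. t * ?I t \<partial>\<mu>) - (\<integral>u. max 0 (u - m) \<partial>\<mu>))" .
  also have "(\<lambda>t. f t * (t * ?I t) - (1 - cdf \<mu> t) * ?I t) = (\<lambda>t. f t * (\<phi> t * ?I t))"
  proof
    fix t
    show "f t * (t * ?I t) - (1 - cdf \<mu> t) * ?I t = f t * (\<phi> t * ?I t)"
      using assms[of t] by (cases "f t = 0") (auto simp: virtual_value_def field_simps split: split_indicator)
  qed
  also have "(\<integral>t. t * ?I t \<partial>\<mu>) - (\<integral>u. max 0 (u - m) \<partial>\<mu>) = (\<integral>t. t * ?I t - max 0 (t - m) \<partial>\<mu>)"
    using int by (intro Bochner_Integration.integral_diff[symmetric]) auto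
  also have "\<dots> = (\<integral>t. m * ?I t \<partial>\<mu>)"
    by (intro Bochner_Integration.integral_cong) (auto split: split_indicator)
  also have "\<dots> = m * prob {m<..}" by simp
  finally show ?thesis
    by (subst has_bochner_integral_val_dist) auto
qed

text \<open>Up to the values off the support and the point \<open>Inf S\<close>, which are null, an
  up-closed part of the support is a ray. A point of density zero above \<open>Inf S\<close> lies to
  the right of the whole support, since the support is an interval; this is what
  \<open>integral_virtual_above\<close> asks for.\<close>

lemma up_closed_supp:
  assumes S: "S \<subseteq> val_supp f" "S \<noteq> {}" "bdd_below S"
    and up: "\<And>s t. s \<in> S \<Longrightarrow> t \<in> val_supp f \<Longrightarrow> s \<le> t \<Longrightarrow> t \<in> S"
  shows "AE t in \<mu>. t \<in> S \<longleftrightarrow> Inf S < t"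
    and "has_bochner_integral \<mu> (\<lambda>t. \<phi> t * indicator {Inf S<..} t) (Inf S * prob {Inf S<..})"
proof -
  show "AE t in \<mu>. t \<in> S \<longleftrightarrow> Inf S < t"
    using AE_supp AE_neq[of "Inf S"]
  proof eventually_elim
    case (elim t)
    have "t \<in> S" if lt: "Inf S < t"
    proof -
      obtain u where u: "u \<in> S" "u < t" using cInf_lessD[OF S(2) lt] by blast
      have "t \<in> val_supp f" using elim by (simp add: val_supp_def)
      from up[OF u(1) this less_imp_le[OF u(2)]] show ?thesis .
    qed
    moreover have "Inf S < t" if "t \<in> S" using cInf_lower[OF that S(3)] elim by simp
    ultimately show ?case by blast
  qed
  show "has_bochner_integral \<mu> (\<lambda>t. \<phi> t * indicator {Inf S<..} t) (Inf S * prob {Inf S<..})"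
  proof (rule integral_virtual_above)
    fix t assume t: "Inf S < t" "f t = 0"
    obtain u where u: "u \<in> S" "u < t" using cInf_lessD[OF S(2) t(1)] by blast
    have "AE s in \<mu>. s \<le> t" using AE_supp
    proof eventually_elim
      case (elim s)
      show ?case
      proof (rule ccontr)
        assume "\<not> s \<le> t"
        then have "t \<le> s" by simp
        have "u \<in> val_supp f" "s \<in> val_supp f" using u(1) S(1) elim by (auto simp: val_supp_def)
        from mem_is_interval_1_I[OF supp_interval this less_imp_le[OF u(2)] \<open>t \<le> s\<close>]
        show False using t(2) by (simp add: val_supp_def)
      qed
    qed
    moreover have "prob {s \<in> space \<mu>. s \<le> t} = 1 \<longleftrightarrow> (AE s in \<mu>. s \<le> t)"
      by (rule prob_Collect_eq_1) simp
    ultimately show "cdf \<mu> t = 1" by (simp add: cdf_def atMost_def)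
  qed
qed

text \<open>\<open>S\<close> stands for the values at which a service is sold and \<open>q\<close>
  for its price. The price can be raised to \<open>Inf S\<close> without losing sales, up to a null
  set, and then Myerson's identity applies.\<close>

lemma menu_price_bound:
  assumes S: "S \<in> sets borel" "S \<subseteq> val_supp f"
    and up: "\<And>s t. s \<in> S \<Longrightarrow> t \<in> val_supp f \<Longrightarrow> s \<le> t \<Longrightarrow> t \<in> S"
    and q: "\<And>s. s \<in> S \<Longrightarrow> q \<le> s"
  shows "q * prob S \<le> (\<integral>t. max 0 (\<phi> t) * indicator S t \<partial>\<mu>)"
proof (cases "S = {}")
  case False
  have bdd: "bdd_below S" using q by (rule bdd_belowI)
  have I: "AE t in \<mu>. t \<in> S \<longleftrightarrow> Inf S < t"
      "has_bochner_integral \<mu> (\<lambda>t. \<phi> t * indicator {Inf S<..} t) (Inf S * prob {Inf S<..})"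
    by (rule up_closed_supp[OF S(2) False bdd], erule (2) up)+
  have "prob S = prob {Inf S<..}"
    using I(1) S(1) by (intro finite_measure_eq_AE) auto
  moreover have "q \<le> Inf S" using q False by (intro cInf_greatest) auto
  ultimately have "q * prob S \<le> Inf S * prob {Inf S<..}" by (simp add: mult_right_mono)
  also have "\<dots> = (\<integral>t. \<phi> t * indicator {Inf S<..} t \<partial>\<mu>)" using I(2) by (simp add: has_bochner_integral_iff)
  also have "\<dots> \<le> (\<integral>t. max 0 (\<phi> t) * indicator S t \<partial>\<mu>)"
  proof (rule integral_mono_AE)
    show "integrable \<mu> (\<lambda>t. \<phi> t * indicator {Inf S<..} t)" using I(2) by (simp add: has_bochner_integral_iff)
    show "integrable \<mu> (\<lambda>t. max 0 (\<phi> t) * indicator S t)"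
      using integrable_pos_part[of 0] S(1) by (intro integrable_real_mult_indicator) auto
    show "AE t in \<mu>. \<phi> t * indicator {Inf S<..} t \<le> max 0 (\<phi> t) * indicator S t"
      using I(1) by eventually_elim (auto split: split_indicator)
  qed
  finally show ?thesis .
qed simp

text \<open>Since a virtual value is at most the value, all values reaching \<open>T\<close> are at
  least \<open>T\<close>; by regularity they form an up-closed set. Its infimum \<open>r\<close> is
  the price, and Myerson's identity turns the expected excess of the virtual value over
  \<open>T\<close> into the revenue beyond \<open>T\<close> at price \<open>r\<close>.\<close>

lemma virtual_inv_cases:
  obtains (none) "virtual_inv f T = \<infinity>" "(\<integral>t. max 0 (\<phi> t - T) \<partial>\<mu>) = 0"
  | (price) r where "virtual_inv f T = ereal r" "T \<le> r"
      "(\<integral>t. max 0 (\<phi> t - T) \<partial>\<mu>) = (r - T) * prob {r<..}"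
proof -
  define P where "P = {v \<in> val_supp f. T \<le> \<phi> v}"
  have inv: "virtual_inv f T = (INF v\<in>P. ereal v)" by (simp add: virtual_inv_def P_def)
  show thesis
  proof (cases "P = {}")
    case True
    have "AE t in \<mu>. max 0 (\<phi> t - T) = 0"
      using AE_supp
    proof eventually_elim
      case (elim t)
      have "\<not> T \<le> \<phi> t" using True elim by (auto simp: P_def val_supp_def)
      then show ?case by simp
    qed
    then have "(\<integral>t. max 0 (\<phi> t - T) \<partial>\<mu>) = (\<integral>t. 0 \<partial>\<mu>)" by (intro integral_cong_AE) auto
    then show thesis using none inv True by (simp add: top_ereal_def)
  next
    case False
    have ge: "T \<le> v" if "v \<in> P" for v using that virtual_le[of v] by (simp add: P_def)
    have bdd: "bdd_below P" using ge by (rule bdd_belowI)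
    have up: "t \<in> P" if "s \<in> P" "t \<in> val_supp f" "s \<le> t" for s t
      using that mono_onD[OF mono_virtual, of s t] by (auto simp: P_def)
    have sub: "P \<subseteq> val_supp f" by (auto simp: P_def)
    have I: "AE t in \<mu>. t \<in> P \<longleftrightarrow> Inf P < t"
        "has_bochner_integral \<mu> (\<lambda>t. \<phi> t * indicator {Inf P<..} t) (Inf P * prob {Inf P<..})"
      by (rule up_closed_supp[OF sub False bdd], erule (2) up)+
    have "virtual_inv f T = ereal (Inf P)"
      unfolding inv using ereal_Inf'[OF bdd False] by simp
    moreover have "T \<le> Inf P" using ge False by (intro cInf_greatest) auto
    moreover have "(\<integral>t. max 0 (\<phi> t - T) \<partial>\<mu>) = (Inf P - T) * prob {Inf P<..}"
    proof -
      have "(\<integral>t. max 0 (\<phi> t - T) \<partial>\<mu>)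
          = (\<integral>t. \<phi> t * indicator {Inf P<..} t - T * indicator {Inf P<..} t \<partial>\<mu>)"
      proof (rule integral_cong_AE)
        show "AE t in \<mu>. max 0 (\<phi> t - T)
            = \<phi> t * indicator {Inf P<..} t - T * indicator {Inf P<..} t"
          using I(1) AE_supp
          by eventually_elim (auto simp: P_def val_supp_def split: split_indicator)
      qed auto
      also have "\<dots> = (\<integral>t. \<phi> t * indicator {Inf P<..} t \<partial>\<mu>) - (\<integral>t. T * indicator {Inf P<..} t \<partial>\<mu>)"
        using I(2) by (intro Bochner_Integration.integral_diff) (auto simp: has_bochner_integral_iff)
      also have "\<dots> = (Inf P - T) * prob {Inf P<..}"
        using I(2) by (simp add: has_bochner_integral_iff algebra_simps)
      finally show ?thesis .
    qed
    ultimately show thesis by (rule price)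
  qed
qed

end

section \<open>Product laws and the setting\<close>

text \<open>Checked on boxes: the preimage of a box is the box with coordinate \<open>x\<close>
  freed, times the side at \<open>x\<close>.\<close>

lemma (in product_prob_space) distr_PiM_update:
  assumes fin: "finite I" and x: "x \<in> I"
  shows "distr (Pi\<^sub>M I M \<Otimes>\<^sub>M M x) (Pi\<^sub>M I M) (\<lambda>(v, t). v(x := t)) = Pi\<^sub>M I M"
proof (rule PiM_eqI[OF fin])
  have [measurable]: "(\<lambda>(v, t). v(x := t)) \<in> measurable (Pi\<^sub>M I M \<Otimes>\<^sub>M M x) (Pi\<^sub>M I M)"
    using measurable_fun_upd[of I I x fst "Pi\<^sub>M I M \<Otimes>\<^sub>M M x" M snd] x
    by (auto simp: split_beta' insert_absorb)
  fix A assume A: "\<And>i. i \<in> I \<Longrightarrow> A i \<in> sets (M i)"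
  define A' where "A' = A(x := space (M x))"
  have A': "A' i \<in> sets (M i)" if "i \<in> I" for i using A that by (simp add: A'_def)
  have S: "Pi\<^sub>E I A \<in> sets (Pi\<^sub>M I M)" "Pi\<^sub>E I A' \<in> sets (Pi\<^sub>M I M)"
    using A A' by (auto intro!: sets_PiM_I_finite fin)
  have sub: "A i \<subseteq> space (M i)" if "i \<in> I" for i using sets.sets_into_space[OF A[OF that]] .
  have "(\<lambda>(v, t). v(x := t)) -` Pi\<^sub>E I A \<inter> space (Pi\<^sub>M I M \<Otimes>\<^sub>M M x) = Pi\<^sub>E I A' \<times> A x" (is "?l = ?r")
  proof (intro set_eqI)
    fix z :: "('i \<Rightarrow> 'a) \<times> 'a"
    obtain v t where z: "z = (v, t)" by (cases z)
    show "z \<in> ?l \<longleftrightarrow> z \<in> ?r"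
      unfolding z using x sub
      by (auto simp: A'_def space_pair_measure space_PiM PiE_iff extensional_def split: if_splits)
  qed
  then have "emeasure (distr (Pi\<^sub>M I M \<Otimes>\<^sub>M M x) (Pi\<^sub>M I M) (\<lambda>(v, t). v(x := t))) (Pi\<^sub>E I A)
      = emeasure (Pi\<^sub>M I M \<Otimes>\<^sub>M M x) (Pi\<^sub>E I A' \<times> A x)"
    using S(1) by (subst emeasure_distr) auto
  also have "\<dots> = emeasure (Pi\<^sub>M I M) (Pi\<^sub>E I A') * emeasure (M x) (A x)"
    using S(2) A x by (intro M.emeasure_pair_measure_Times) auto
  also have "emeasure (Pi\<^sub>M I M) (Pi\<^sub>E I A') = (\<Prod>i\<in>I. emeasure (M i) (A' i))"
    using A' by (intro emeasure_PiM fin) auto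
  also have "\<dots> = (\<Prod>i\<in>I - {x}. emeasure (M i) (A i))"
    using fin x by (subst prod.remove[of I x]) (auto simp: A'_def M.emeasure_space_1 intro!: prod.cong)
  also have "\<dots> * emeasure (M x) (A x) = (\<Prod>i\<in>I. emeasure (M i) (A i))"
    using prod.remove[OF fin x, of "\<lambda>i. emeasure (M i) (A i)"] by (simp add: mult.commute)
  finally show "emeasure (distr (Pi\<^sub>M I M \<Otimes>\<^sub>M M x) (Pi\<^sub>M I M) (\<lambda>(v, t). v(x := t))) (Pi\<^sub>E I A)
      = (\<Prod>i\<in>I. emeasure (M i) (A i))" .
qed simp

section \<open>Value profiles and their product law\<close>

locale bmumd_env =
  fixes E :: "'u bmumd"
  assumes setting: "bmumd_setting E"
begin

abbreviation "U \<equiv> services E"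
abbreviation "P \<equiv> value_law E"
abbreviation "D x \<equiv> val_dist (dens E x)"
abbreviation "J \<equiv> interest E"
abbreviation "n \<equiv> bidders E"
abbreviation "p \<equiv> num_mat E"
abbreviation "w \<equiv> weight E"

lemma finite_U [simp]: "finite U"
  and union_J: "(\<Union>i\<in>{1..n}. J i) = U"
  and disjoint_J: "disjoint_family_on J {1..n}"
  and p_pos: "1 \<le> p"
  using setting unfolding bmumd_setting_def by blast+

lemma matroids: "j \<in> {1..p} \<Longrightarrow> matroid U (indep E j)"
  and unit_demand: "S \<in> feasible E \<Longrightarrow> i \<in> {1..n} \<Longrightarrow> card (S \<inter> J i) \<le> 1"
  and regular_dens: "x \<in> U \<Longrightarrow> regular_density (dens E x)"
  using setting unfolding bmumd_setting_def by blast+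

lemma J_subset: "i \<in> {1..n} \<Longrightarrow> J i \<subseteq> U"
  using union_J by blast

lemma J_unique: "i \<in> {1..n} \<Longrightarrow> k \<in> {1..n} \<Longrightarrow> x \<in> J i \<Longrightarrow> x \<in> J k \<Longrightarrow> i = k"
  using disjoint_family_onD[OF disjoint_J, of i k] by blast

lemma finite_J: "i \<in> {1..n} \<Longrightarrow> finite (J i)"
  by (rule finite_subset[OF J_subset]) auto

lemma sum_bidders: "(\<Sum>i=1..n. \<Sum>x\<in>J i. g x) = (\<Sum>x\<in>U. g x)" for g :: "'u \<Rightarrow> real"
proof -
  have "(\<Sum>x\<in>(\<Union>i\<in>{1..n}. J i). g x) = (\<Sum>i\<in>{1..n}. \<Sum>x\<in>J i. g x)"
  proof (rule sum.UNION_disjoint)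
    show "\<forall>i\<in>{1..n}. finite (J i)" using finite_J by blast
    show "\<forall>i\<in>{1..n}. \<forall>k\<in>{1..n}. i \<noteq> k \<longrightarrow> J i \<inter> J k = {}"
      using disjoint_family_onD[OF disjoint_J] by blast
  qed simp
  then show ?thesis unfolding union_J by (rule sym)
qed

lemma feasible_indep: "S \<in> feasible E \<Longrightarrow> j \<in> {1..p} \<Longrightarrow> S \<in> indep E j"
  by (simp add: feasible_def)

lemma feasible_subset: "S \<in> feasible E \<Longrightarrow> T \<subseteq> S \<Longrightarrow> T \<in> feasible E"
  by (auto simp: feasible_def intro: matroid_subset[OF matroids])

lemma empty_feasible: "{} \<in> feasible E"
proof -
  have "{} \<in> indep E j" if "j \<in> {1..p}" for j
    using matroids[OF that] unfolding matroid_def by (elim conjE)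
  then show ?thesis unfolding feasible_def by blast
qed

lemma feasible_services: "S \<in> feasible E \<Longrightarrow> S \<subseteq> U"
proof -
  assume S: "S \<in> feasible E"
  have 1: "1 \<in> {1..p}" using p_pos by simp
  have "indep E 1 \<subseteq> Pow U" using matroids[OF 1] unfolding matroid_def by (elim conjE)
  then show ?thesis using feasible_indep[OF S 1] by blast
qed

lemma feasible_finite: "S \<in> feasible E \<Longrightarrow> finite S"
  using feasible_services finite_U by (rule finite_subset)

lemma finite_feasible: "finite (feasible E)"
  by (rule finite_subset[of _ "Pow U"]) (use feasible_services in auto)

lemma regular_dist: "x \<in> U \<Longrightarrow> regular_dist (dens E x)"
  by (simp add: regular_dist_def regular_dens)

lemma prob_D: "x \<in> U \<Longrightarrow> prob_space (D x)"
  using regular_dens by (auto simp: regular_density_def)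

lemma measurable_component [measurable]: "x \<in> U \<Longrightarrow> (\<lambda>v. v x) \<in> borel_measurable P"
  unfolding value_law_def
  using measurable_component_singleton[of x U D] by simp

sublocale prob_space P
  unfolding value_law_def by (intro prob_space_PiM prob_D)

lemma distr_component: "x \<in> U \<Longrightarrow> distr P (D x) (\<lambda>v. v x) = D x"
  unfolding value_law_def by (rule distr_PiM_component) (rule prob_D)

lemma integral_component:
  fixes g :: "real \<Rightarrow> real"
  assumes x: "x \<in> U" and [measurable]: "g \<in> borel_measurable borel"
  shows "(\<integral>v. g (v x) \<partial>P) = (\<integral>t. g t \<partial>D x)"
proof -
  have "(\<integral>t. g t \<partial>distr P (D x) (\<lambda>v. v x)) = (\<integral>v. g (v x) \<partial>P)"
    using x by (intro integral_distr) (simp_all cong: measurable_cong_sets)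
  then show ?thesis by (simp add: distr_component[OF x])
qed

lemma integrable_component:
  fixes g :: "real \<Rightarrow> real"
  assumes x: "x \<in> U" and g: "integrable (D x) g"
  shows "integrable P (\<lambda>v. g (v x))"
proof -
  have "(\<lambda>v. v x) \<in> P \<rightarrow>\<^sub>M D x" using x by (simp cong: measurable_cong_sets)
  moreover have "integrable (distr P (D x) (\<lambda>v. v x)) g" by (simp add: distr_component[OF x] g)
  ultimately show ?thesis by (rule integrable_distr)
qed

lemma AE_type_space: "AE v in P. v \<in> type_space E"
proof -
  have "AE v in P. \<forall>x\<in>U. v x \<in> val_supp (dens E x)"
  proof (rule AE_finite_allI[OF finite_U])
    fix x assume x: "x \<in> U"
    have "AE t in D x. t \<in> val_supp (dens E x)"
      using regular_dist.AE_supp[OF regular_dist[OF x]] by (simp add: val_supp_def)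
    then show "AE v in P. v x \<in> val_supp (dens E x)"
      unfolding value_law_def using x by (intro AE_PiM_component prob_D)
  qed
  then show ?thesis
    using AE_space by eventually_elim
      (auto simp: type_space_def value_law_def space_PiM PiE_iff)
qed

lemma type_space_subset: "type_space E \<subseteq> space P"
  by (auto simp: type_space_def value_law_def space_PiM PiE_iff)

lemma distr_resample: "x \<in> U \<Longrightarrow> distr (P \<Otimes>\<^sub>M D x) P (\<lambda>(v, t). v(x := t)) = P"
proof -
  assume x: "x \<in> U"
  \<comment> \<open>\<open>product_prob_space\<close> asks for a probability measure at every index,
    so the laws outside \<open>U\<close> are replaced by a point mass; the product over
    \<open>U\<close> stays the same.\<close>
  define N where "N y = (if y \<in> U then D y else return borel 0)" for y
  have "prob_space (N y)" for y
    by (auto simp: N_def prob_D intro: prob_space_return)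
  then interpret N: product_prob_space N U
    by (simp add: product_prob_space_def product_prob_space_axioms_def product_sigma_finite_def
        prob_space_imp_sigma_finite)
  have "P = Pi\<^sub>M U N" unfolding value_law_def by (rule PiM_cong) (simp_all add: N_def)
  moreover have "D x = N x" using x by (simp add: N_def)
  ultimately show ?thesis using N.distr_PiM_update[OF finite_U x] by simp
qed

lemma measurable_resample [measurable]:
  "x \<in> U \<Longrightarrow> (\<lambda>(v, t). v(x := t)) \<in> measurable (P \<Otimes>\<^sub>M D x) P"
  unfolding value_law_def
  using measurable_fun_upd[of U U x fst "Pi\<^sub>M U D \<Otimes>\<^sub>M D x" D snd]
  by (auto simp: split_beta' insert_absorb)

lemma measurable_resample' [measurable]:
  assumes "x \<in> U" "v \<in> space P" shows "(\<lambda>t. v(x := t)) \<in> measurable (D x) P"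
  using measurable_compose[OF measurable_Pair1'[OF assms(2), of "D x"] measurable_resample[OF assms(1)]]
  by simp

text \<open>Change of variables under \<open>distr_resample\<close>, followed by Fubini. It reduces
  a claim about the whole profile to the one-dimensional law of \<open>v x\<close> with the other
  values held fixed.\<close>

lemma integral_resample:
  fixes g :: "('u \<Rightarrow> real) \<Rightarrow> real"
  assumes x: "x \<in> U" and g: "integrable P g"
  shows "(\<integral>v. g v \<partial>P) = (\<integral>v. (\<integral>t. g (v(x := t)) \<partial>D x) \<partial>P)"
    and "integrable P (\<lambda>v. \<integral>t. g (v(x := t)) \<partial>D x)"
    and "AE v in P. integrable (D x) (\<lambda>t. g (v(x := t)))"
proof -
  interpret D: prob_space "D x" by (rule prob_D[OF x])
  interpret pair_sigma_finite P "D x" ..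
  have "integrable (P \<Otimes>\<^sub>M D x) (\<lambda>z. g (case z of (v, t) \<Rightarrow> v(x := t)))"
    by (rule integrable_distr[OF measurable_resample[OF x]]) (simp add: distr_resample[OF x] g)
  then have int: "integrable (P \<Otimes>\<^sub>M D x) (\<lambda>(v, t). g (v(x := t)))" by (simp add: split_beta')
  have "(\<integral>v. g v \<partial>P) = (\<integral>v. g v \<partial>distr (P \<Otimes>\<^sub>M D x) P (\<lambda>(v, t). v(x := t)))"
    by (simp add: distr_resample[OF x])
  also have "\<dots> = (\<integral>z. g (case z of (v, t) \<Rightarrow> v(x := t)) \<partial>(P \<Otimes>\<^sub>M D x))"
    using g by (intro integral_distr measurable_resample x) auto
  also have "\<dots> = (\<integral>(v, t). g (v(x := t)) \<partial>(P \<Otimes>\<^sub>M D x))" by (simp add: split_beta')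
  also have "\<dots> = (\<integral>v. (\<integral>t. g (v(x := t)) \<partial>D x) \<partial>P)" by (rule integral_fst[OF int, symmetric])
  finally show "(\<integral>v. g v \<partial>P) = (\<integral>v. (\<integral>t. g (v(x := t)) \<partial>D x) \<partial>P)" .
  show "integrable P (\<lambda>v. \<integral>t. g (v(x := t)) \<partial>D x)" by (rule integrable_fst[OF int])
  show "AE v in P. integrable (D x) (\<lambda>t. g (v(x := t)))" by (rule AE_integrable_fst[OF int])
qed

lemma AE_component_neq:
  assumes x: "x \<in> U" shows "AE v in P. v x \<noteq> c"
  unfolding value_law_def
  using regular_dist.AE_neq[OF regular_dist[OF x], of c] x by (intro AE_PiM_component prob_D)

text \<open>When \<open>v x\<close> is resampled, \<open>v y\<close> stays fixed, and the law of
  \<open>v x\<close> has no atoms.\<close>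

lemma AE_component_diff_neq:
  assumes x: "x \<in> U" and y: "y \<in> U" and xy: "x \<noteq> y"
  shows "AE v in P. v x - v y \<noteq> c"
proof -
  interpret D: prob_space "D x" by (rule prob_D[OF x])
  interpret pair_sigma_finite P "D x" ..
  have "AE z in P \<Otimes>\<^sub>M D x. snd z - fst z y \<noteq> c"
  proof (rule AE_pair_measure)
    have [measurable]: "(\<lambda>v. v y) \<in> borel_measurable P" using y by measurable
    show "{z \<in> space (P \<Otimes>\<^sub>M D x). snd z - fst z y \<noteq> c} \<in> sets (P \<Otimes>\<^sub>M D x)" by measurable
    show "AE v in P. AE t in D x. snd (v, t) - fst (v, t) y \<noteq> c"
    proof (rule AE_I2)
      fix v show "AE t in D x. snd (v, t) - fst (v, t) y \<noteq> c"
        using regular_dist.AE_neq[OF regular_dist[OF x], of "c + v y"] by eventually_elim auto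
    qed
  qed
  then have "AE z in P \<Otimes>\<^sub>M D x. (case z of (v, t) \<Rightarrow> v(x := t)) x - (case z of (v, t) \<Rightarrow> v(x := t)) y \<noteq> c"
    by eventually_elim (use xy in \<open>auto simp: split_beta'\<close>)
  then have "AE v in distr (P \<Otimes>\<^sub>M D x) P (\<lambda>(v, t). v(x := t)). v x - v y \<noteq> c"
    using x y by (subst AE_distr_iff) (auto intro: measurable_resample)
  then show ?thesis unfolding distr_resample[OF x] .
qed

lemma measurable_weight [measurable]: "x \<in> U \<Longrightarrow> (\<lambda>v. w v x) \<in> borel_measurable P"
  unfolding weight_def
  by (rule measurable_compose[OF measurable_component])
    (simp_all add: regular_dist.measurable_virtual[OF regular_dist])

lemma integrable_abs_value: "x \<in> U \<Longrightarrow> integrable P (\<lambda>v. \<bar>v x\<bar>)"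
  using integrable_component[of x "\<lambda>t. \<bar>t\<bar>"] regular_dist.integrable_id[OF regular_dist] by simp

lemma weight_le: "x \<in> U \<Longrightarrow> w v x \<le> \<bar>v x\<bar>"
  using regular_dist.virtual_le[OF regular_dist, of x "v x"] by (simp add: weight_def)

end

section \<open>The virtual surplus bounds the optimal revenue\<close>

locale bmumd_selection = bmumd_env E for E :: "'u bmumd" +
  fixes B :: "('u \<Rightarrow> real) \<Rightarrow> 'u set"
  assumes selection: "max_weight_selection E B"
begin

text \<open>An integrable upper bound for the weights of subsets of \<open>B\<close> and for the
  payments.\<close>

definition total_value :: "('u \<Rightarrow> real) \<Rightarrow> real" where
  "total_value v = (\<Sum>x\<in>U. \<bar>v x\<bar>)"

text \<open>The quantity \<open>W\<close> of the proof idea.\<close>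

definition opt_weight :: real where
  "opt_weight = (\<integral>s. sum (w s) (B s) \<partial>P)"

lemma integrable_total: "integrable P total_value"
  unfolding total_value_def by (intro Bochner_Integration.integrable_sum integrable_abs_value)

lemma total_value_mono: "S \<subseteq> U \<Longrightarrow> (\<Sum>x\<in>S. \<bar>v x\<bar>) \<le> total_value v"
  unfolding total_value_def by (intro sum_mono2) auto

lemma B_feasible: "s \<in> space P \<Longrightarrow> B s \<in> feasible E"
  and B_max: "s \<in> space P \<Longrightarrow> S \<in> feasible E \<Longrightarrow> sum (w s) S \<le> sum (w s) (B s)"
  using selection by (auto simp: max_weight_selection_def is_arg_max_linorder)

lemma B_services: "s \<in> space P \<Longrightarrow> B s \<subseteq> U"
  by (rule feasible_services[OF B_feasible])

lemma finite_B: "s \<in> space P \<Longrightarrow> finite (B s)"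
  by (rule feasible_finite[OF B_feasible])

text \<open>Discarding an element of negative weight would leave a heavier feasible set.\<close>

lemma B_nonneg:
  assumes s: "s \<in> space P" and y: "y \<in> B s" shows "0 \<le> w s y"
proof -
  have "B s - {y} \<in> feasible E" by (rule feasible_subset[OF B_feasible[OF s]]) auto
  from B_max[OF s this] show ?thesis using sum.remove[OF finite_B[OF s] y, of "w s"] by simp
qed

lemma sum_weight_le_total:
  assumes "s \<in> space P" "S \<subseteq> B s" shows "sum (w s) S \<le> total_value s"
proof -
  have SU: "S \<subseteq> U" using assms B_services by blast
  then have "sum (w s) S \<le> (\<Sum>x\<in>S. \<bar>s x\<bar>)" by (intro sum_mono weight_le) auto
  also have "\<dots> \<le> total_value s" by (rule total_value_mono[OF SU])
  finally show ?thesis .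
qed

text \<open>The finite target \<open>feasible E\<close> lets later measurability proofs fix the
  value of \<open>g\<close> and treat one feasible set at a time.\<close>

lemma measurable_feasible:
  assumes "g \<in> measurable P (count_space UNIV)" "\<And>v. v \<in> space P \<Longrightarrow> g v \<in> feasible E"
  shows "g \<in> measurable P (count_space (feasible E))"
  using assms by (subst measurable_count_space_eq2[OF finite_feasible]) auto

lemma measurable_B: "B \<in> measurable P (count_space (feasible E))"
  using selection B_feasible by (intro measurable_feasible) (auto simp: max_weight_selection_def)

lemma measurable_sum_weight: "S \<subseteq> U \<Longrightarrow> (\<lambda>s. sum (w s) S) \<in> borel_measurable P"
  by (intro borel_measurable_sum measurable_weight) auto

lemma integrable_weight_B: "integrable P (\<lambda>s. sum (w s) (B s))"
proof (rule Bochner_Integration.integrable_bound[OF integrable_total])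
  show "(\<lambda>s. sum (w s) (B s)) \<in> borel_measurable P"
    by (rule measurable_compose_countable'[where f = "\<lambda>S s. sum (w s) S", OF _ measurable_B])
      (simp_all add: measurable_sum_weight feasible_services finite_feasible countable_finite)
  show "AE s in P. norm (sum (w s) (B s)) \<le> norm (total_value s)"
  proof (rule AE_I2)
    fix s assume s: "s \<in> space P"
    have "0 \<le> sum (w s) (B s)" by (intro sum_nonneg B_nonneg[OF s])
    then show "norm (sum (w s) (B s)) \<le> norm (total_value s)"
      using sum_weight_le_total[OF s order_refl] by simp
  qed
qed

section \<open>Revenue of a single admissible mechanism\<close>

context
  fixes M :: "'u mechanism"
  assumes admissible: "M \<in> admissible_mechanisms E"
begin

lemma alloc_feasible: "v \<in> type_space E \<Longrightarrow> alloc M v \<in> feasible E"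
  and rational: "v \<in> type_space E \<Longrightarrow> i \<in> {1..n} \<Longrightarrow> 0 \<le> mech_utility E M i v v"
  and truth: "v \<in> type_space E \<Longrightarrow> i \<in> {1..n} \<Longrightarrow> r \<in> type_space E \<Longrightarrow>
        (\<And>x. x \<in> U \<Longrightarrow> x \<notin> J i \<Longrightarrow> r x = v x) \<Longrightarrow> mech_utility E M i v r \<le> mech_utility E M i v v"
  and measurable_alloc [measurable]: "alloc M \<in> measurable P (count_space UNIV)"
  and measurable_pay: "i \<in> {1..n} \<Longrightarrow> (\<lambda>v. pay M v i) \<in> borel_measurable P"
  and integrable_payments: "integrable P (\<lambda>v. \<Sum>i=1..n. pay M v i)"
  using admissible
  unfolding admissible_mechanisms_def feasible_mechanism_def individually_rational_def truthful_def
  by blast+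

lemma alloc_single:
  assumes "v \<in> type_space E" "i \<in> {1..n}" "x \<in> J i" "x \<in> alloc M v"
  shows "alloc M v \<inter> J i = {x}"
proof -
  have "card (alloc M v \<inter> J i) \<le> 1" by (rule unit_demand[OF alloc_feasible[OF assms(1)] assms(2)])
  moreover have "finite (alloc M v \<inter> J i)" using finite_J[OF assms(2)] by simp
  ultimately show ?thesis using assms(3,4) by (auto simp: card_le_Suc0_iff_eq)
qed

lemma utility_single:
  assumes "r \<in> type_space E" "i \<in> {1..n}" "x \<in> J i" "x \<in> alloc M r"
  shows "mech_utility E M i v r = v x - pay M r i"
  by (simp add: mech_utility_def alloc_single[OF assms])

lemma pay_le_values:
  assumes v: "v \<in> type_space E" and i: "i \<in> {1..n}"
  shows "pay M v i \<le> (\<Sum>x\<in>J i. \<bar>v x\<bar>)"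
proof -
  have "pay M v i \<le> (\<Sum>x\<in>alloc M v \<inter> J i. v x)" using rational[OF v i] by (simp add: mech_utility_def)
  also have "\<dots> \<le> (\<Sum>x\<in>alloc M v \<inter> J i. \<bar>v x\<bar>)" by (intro sum_mono) auto
  also have "\<dots> \<le> (\<Sum>x\<in>J i. \<bar>v x\<bar>)" using finite_J[OF i] by (intro sum_mono2) auto
  finally show ?thesis .
qed

text \<open>Only the total payment is assumed integrable. Each payment is bounded above by
  \<open>total_value\<close>, and below because it is the total minus the other payments, which are
  bounded above too.\<close>

lemma integrable_pay:
  assumes i: "i \<in> {1..n}" shows "integrable P (\<lambda>v. pay M v i)"
proof (rule Bochner_Integration.integrable_bound)
  let ?S = "\<lambda>v. \<Sum>i=1..n. pay M v i"
  show "integrable P (\<lambda>v. \<bar>?S v\<bar> + total_value v)"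
    using integrable_payments integrable_total by auto
  show "AE v in P. norm (pay M v i) \<le> norm (\<bar>?S v\<bar> + total_value v)"
    using AE_type_space
  proof eventually_elim
    case (elim v)
    have "pay M v i \<le> (\<Sum>x\<in>J i. \<bar>v x\<bar>)" by (rule pay_le_values[OF elim i])
    also have "\<dots> \<le> total_value v" by (rule total_value_mono[OF J_subset[OF i]])
    finally have up: "pay M v i \<le> total_value v" .
    have "?S v - pay M v i = (\<Sum>k\<in>{1..n} - {i}. pay M v k)"
      using sum.remove[of "{1..n}" i "\<lambda>k. pay M v k"] i by simp
    also have "\<dots> \<le> (\<Sum>k\<in>{1..n} - {i}. \<Sum>x\<in>J k. \<bar>v x\<bar>)" by (intro sum_mono pay_le_values[OF elim]) auto
    also have "\<dots> \<le> (\<Sum>k=1..n. \<Sum>x\<in>J k. \<bar>v x\<bar>)" by (intro sum_mono2) (auto intro: sum_nonneg)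
    also have "\<dots> = total_value v" unfolding sum_bidders total_value_def ..
    finally show ?case using up by simp
  qed
qed (rule measurable_pay[OF i])

text \<open>With the other values fixed, truthfulness and individual rationality reduce the sale of
  \<open>x\<close> to the situation of \<open>menu_price_bound\<close>;
  \<open>integral_resample\<close> then averages over the other values.\<close>

lemma single_service_revenue:
  assumes i: "i \<in> {1..n}" and x: "x \<in> J i"
  shows "integrable P (\<lambda>v. if x \<in> alloc M v then pay M v i else 0)" (is "integrable P ?\<Psi>")
    and "integrable P (\<lambda>v. if x \<in> alloc M v then max 0 (w v x) else 0)" (is "integrable P ?\<Phi>")
    and "(\<integral>v. (if x \<in> alloc M v then pay M v i else 0) \<partial>P)
      \<le> (\<integral>v. (if x \<in> alloc M v then max 0 (w v x) else 0) \<partial>P)"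
proof -
  have xU: "x \<in> U" using x J_subset[OF i] by auto
  interpret R: regular_dist "dens E x" by (rule regular_dist[OF xU])
  have [measurable]: "(\<lambda>v. x \<in> alloc M v) \<in> measurable P (count_space UNIV)"
    using measurable_compose[OF measurable_alloc, of "\<lambda>S. x \<in> S" "count_space UNIV"] by simp
  have [measurable]: "(\<lambda>v. pay M v i) \<in> borel_measurable P" by (rule measurable_pay[OF i])
  have [measurable]: "(\<lambda>v. w v x) \<in> borel_measurable P" by (rule measurable_weight[OF xU])
  show i1: "integrable P ?\<Psi>"
    by (rule Bochner_Integration.integrable_bound[OF integrable_pay[OF i]]) auto
  show i2: "integrable P ?\<Phi>"
  proof (rule Bochner_Integration.integrable_bound[OF integrable_abs_value[OF xU]])
    show "AE v in P. norm (?\<Phi> v) \<le> norm \<bar>v x\<bar>"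
      using weight_le[OF xU] by (intro AE_I2) auto
  qed measurable
  have "AE v in P. (\<integral>t. ?\<Psi> (v(x := t)) \<partial>D x) \<le> (\<integral>t. ?\<Phi> (v(x := t)) \<partial>D x)"
    using AE_type_space
  proof eventually_elim
    case (elim v)
    define S where "S = {t \<in> val_supp (dens E x). x \<in> alloc M (v(x := t))}"
    have vsp: "v \<in> space P" using elim type_space_subset by auto
    have m: "(\<lambda>t. v(x := t)) \<in> measurable (D x) P" by (rule measurable_resample'[OF xU vsp])
    have "(\<lambda>t. x \<in> alloc M (v(x := t))) \<in> measurable (D x) (count_space UNIV)"
      by (rule measurable_compose[OF m]) measurable
    then have [measurable]: "Measurable.pred borel (\<lambda>t. x \<in> alloc M (v(x := t)))"
      by (simp cong: measurable_cong_sets)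
    have S [measurable]: "S \<in> sets borel" unfolding S_def val_supp_def by measurable
    have ts: "v(x := t) \<in> type_space E" if "t \<in> val_supp (dens E x)" for t
      using elim xU that by (auto simp: type_space_def PiE_iff extensional_def)
    have off: "(v(x := s)) y = (v(x := t)) y" if "y \<notin> J i" for y s t
      using that x by auto
    \<comment> \<open>If both reports win \<open>x\<close>, the cheaper one would be preferred
      whatever the true value, so the payments agree.\<close>
    have const: "pay M (v(x := s)) i = pay M (v(x := t)) i" if "s \<in> S" "t \<in> S" for s t
    proof -
      have *: "pay M (v(x := s)) i \<le> pay M (v(x := t)) i" if "s \<in> S" "t \<in> S" for s t
      proof -
        have sS: "s \<in> val_supp (dens E x)" "x \<in> alloc M (v(x := s))"
          and tS: "t \<in> val_supp (dens E x)" "x \<in> alloc M (v(x := t))"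
          using that by (auto simp: S_def)
        have "mech_utility E M i (v(x := s)) (v(x := t)) \<le> mech_utility E M i (v(x := s)) (v(x := s))"
          by (rule truth[OF ts[OF sS(1)] i ts[OF tS(1)] off])
        then show ?thesis
          using utility_single[OF ts[OF sS(1)] i x sS(2), of "v(x := s)"]
            utility_single[OF ts[OF tS(1)] i x tS(2), of "v(x := s)"] by simp
      qed
      show ?thesis using *[OF that] *[OF that(2,1)] by simp
    qed
    have up: "t \<in> S" if s: "s \<in> S" and t: "t \<in> val_supp (dens E x)" and st: "s \<le> t" for s t
    proof (rule ccontr)
      assume n: "t \<notin> S"
      then have xn: "x \<notin> alloc M (v(x := t))" using t by (simp add: S_def)
      have "s \<noteq> t" using n s by auto
      have sS: "s \<in> val_supp (dens E x)" "x \<in> alloc M (v(x := s))" using s by (auto simp: S_def)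
      \<comment> \<open>A report that loses \<open>x\<close> yields the same utility for both
        values. Comparing it with a report that wins \<open>x\<close>, at each of the two true
        values, gives \<open>t \<le> s\<close>.\<close>
      have "mech_utility E M i (v(x := s)) (v(x := t)) = mech_utility E M i (v(x := t)) (v(x := t))"
        using xn unfolding mech_utility_def by (intro arg_cong2[of _ _ _ _ "(-)"] sum.cong) auto
      moreover have "mech_utility E M i (v(x := s)) (v(x := t)) \<le> mech_utility E M i (v(x := s)) (v(x := s))"
        by (rule truth[OF ts[OF sS(1)] i ts[OF t] off])
      moreover have "mech_utility E M i (v(x := t)) (v(x := s)) \<le> mech_utility E M i (v(x := t)) (v(x := t))"
        by (rule truth[OF ts[OF t] i ts[OF sS(1)] off])
      ultimately have "t \<le> s"
        using utility_single[OF ts[OF sS(1)] i x sS(2), of "v(x := s)"]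
          utility_single[OF ts[OF sS(1)] i x sS(2), of "v(x := t)"] by simp
      then show False using st \<open>s \<noteq> t\<close> by simp
    qed
    \<comment> \<open>By \<open>const\<close> the choice of the winning value does not matter; if
      \<open>S\<close> is empty, \<open>q\<close> is arbitrary but multiplied by an indicator that
      vanishes.\<close>
    define q where "q = pay M (v(x := (SOME s. s \<in> S))) i"
    have q: "pay M (v(x := s)) i = q" if "s \<in> S" for s
      unfolding q_def by (rule const[OF that]) (rule someI[of "\<lambda>s. s \<in> S", OF that])
    have qle: "q \<le> s" if s: "s \<in> S" for s
    proof -
      have sS: "s \<in> val_supp (dens E x)" "x \<in> alloc M (v(x := s))" using s by (auto simp: S_def)
      show ?thesis
        using rational[OF ts[OF sS(1)] i] utility_single[OF ts[OF sS(1)] i x sS(2), of "v(x := s)"] q[OF s]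
        by simp
    qed
    have supp: "AE t in D x. t \<in> val_supp (dens E x)"
      using R.AE_supp by (simp add: val_supp_def)
    have m1: "(\<lambda>t. ?\<Psi> (v(x := t))) \<in> borel_measurable (D x)"
      by (rule measurable_compose[OF m]) measurable
    have m2: "(\<lambda>t. ?\<Phi> (v(x := t))) \<in> borel_measurable (D x)"
      by (rule measurable_compose[OF m]) measurable
    have "(\<integral>t. ?\<Psi> (v(x := t)) \<partial>D x) = (\<integral>t. q * indicator S t \<partial>D x)"
    proof (rule integral_cong_AE[OF m1])
      show "AE t in D x. ?\<Psi> (v(x := t)) = q * indicator S t"
        using supp
      proof eventually_elim
        case (elim t)
        then show ?case using q[of t] by (cases "t \<in> S") (auto simp: S_def)
      qed
    qed simp
    also have "\<dots> = q * R.prob S" by simp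
    also have "\<dots> \<le> (\<integral>t. max 0 (virtual_value (dens E x) t) * indicator S t \<partial>D x)"
      by (rule R.menu_price_bound[OF S _ up qle]) (auto simp: S_def)
    also have "\<dots> = (\<integral>t. ?\<Phi> (v(x := t)) \<partial>D x)"
    proof (rule integral_cong_AE[OF _ m2])
      show "AE t in D x. max 0 (virtual_value (dens E x) t) * indicator S t = ?\<Phi> (v(x := t))"
        using supp by eventually_elim (auto simp: S_def weight_def)
    qed simp
    finally show ?case .
  qed
  then have "(\<integral>v. (\<integral>t. ?\<Psi> (v(x := t)) \<partial>D x) \<partial>P) \<le> (\<integral>v. (\<integral>t. ?\<Phi> (v(x := t)) \<partial>D x) \<partial>P)"
    by (intro integral_mono_AE integral_resample(2)[OF xU i1] integral_resample(2)[OF xU i2])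
  then show "(\<integral>v. ?\<Psi> v \<partial>P) \<le> (\<integral>v. ?\<Phi> v \<partial>P)"
    unfolding integral_resample(1)[OF xU i1] integral_resample(1)[OF xU i2] .
qed

lemma mech_revenue_le: "mech_revenue E M \<le> opt_weight"
proof -
  define \<Psi> where "\<Psi> i x v = (if x \<in> alloc M v then pay M v i else 0)" for i x v
  define \<Phi> where "\<Phi> x v = (if x \<in> alloc M v then max 0 (w v x) else 0)" for x v
  note \<Psi> = single_service_revenue(1)[folded \<Psi>_def]
  note \<Phi> = single_service_revenue(2)[folded \<Phi>_def]
  note le = single_service_revenue(3)[folded \<Psi>_def \<Phi>_def]
  have \<Phi>U: "integrable P (\<Phi> x)" if "x \<in> U" for x
    using that \<Phi> union_J by blast
  have "mech_revenue E M \<le> (\<integral>v. (\<Sum>i=1..n. \<Sum>x\<in>J i. \<Psi> i x v) \<partial>P)"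
    unfolding mech_revenue_def
  proof (rule integral_mono_AE[OF integrable_payments])
    show "integrable P (\<lambda>v. \<Sum>i=1..n. \<Sum>x\<in>J i. \<Psi> i x v)"
      by (intro Bochner_Integration.integrable_sum \<Psi>)
    show "AE v in P. (\<Sum>i=1..n. pay M v i) \<le> (\<Sum>i=1..n. \<Sum>x\<in>J i. \<Psi> i x v)"
      using AE_type_space
    proof eventually_elim
      case (elim v)
      show ?case
      proof (rule sum_mono)
        fix i assume i: "i \<in> {1..n}"
        have fin: "finite (J i)" by (rule finite_J[OF i])
        have eq: "(\<Sum>x\<in>J i. \<Psi> i x v) = (\<Sum>x\<in>alloc M v \<inter> J i. pay M v i)"
          unfolding \<Psi>_def
          using sum.inter_restrict[OF fin, of "\<lambda>_. pay M v i" "alloc M v"]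
          by (simp only: Int_commute)
        \<comment> \<open>A bidder who gets nothing pays at most 0 by individual rationality;
          otherwise exactly one service contributes, and it contributes the payment.\<close>
        show "pay M v i \<le> (\<Sum>x\<in>J i. \<Psi> i x v)"
        proof (cases "alloc M v \<inter> J i = {}")
          case True
          then show ?thesis using rational[OF elim i] by (simp add: eq mech_utility_def)
        next
          case False
          then obtain x where "x \<in> J i" "x \<in> alloc M v" by auto
          then show ?thesis unfolding eq using alloc_single[OF elim i, of x] by simp
        qed
      qed
    qed
  qed
  also have "\<dots> = (\<Sum>i=1..n. \<Sum>x\<in>J i. \<integral>v. \<Psi> i x v \<partial>P)"
    using \<Psi> by (simp add: Bochner_Integration.integral_sum Bochner_Integration.integrable_sum)
  also have "\<dots> \<le> (\<Sum>i=1..n. \<Sum>x\<in>J i. \<integral>v. \<Phi> x v \<partial>P)"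
    by (intro sum_mono le)
  also have "\<dots> = (\<Sum>x\<in>U. \<integral>v. \<Phi> x v \<partial>P)" by (rule sum_bidders)
  also have "\<dots> = (\<integral>v. (\<Sum>x\<in>U. \<Phi> x v) \<partial>P)"
    using \<Phi>U by (intro Bochner_Integration.integral_sum[symmetric])
  also have "\<dots> \<le> opt_weight"
    unfolding opt_weight_def
  proof (rule integral_mono_AE[OF _ integrable_weight_B])
    show "integrable P (\<lambda>v. \<Sum>x\<in>U. \<Phi> x v)" using \<Phi>U by (rule Bochner_Integration.integrable_sum)
    show "AE v in P. (\<Sum>x\<in>U. \<Phi> x v) \<le> sum (w v) (B v)"
      using AE_type_space
    proof eventually_elim
      case (elim v)
      \<comment> \<open>The allocated services of nonnegative weight form a feasible set that
        carries all of the truncated weight.\<close>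
      define A where "A = {x \<in> alloc M v. 0 \<le> w v x}"
      have A: "A \<in> feasible E" by (rule feasible_subset[OF alloc_feasible[OF elim]]) (auto simp: A_def)
      have "(\<Sum>x\<in>U. \<Phi> x v) = (\<Sum>x\<in>A. w v x)"
        by (rule sum.mono_neutral_cong_right[OF finite_U feasible_services[OF A]])
          (auto simp: \<Phi>_def A_def)
      then show ?case using B_max[OF _ A] elim type_space_subset by auto
    qed
  qed
  finally show ?thesis .
qed

end

lemma optimal_revenue_le: "optimal_revenue E \<le> ereal opt_weight"
  unfolding optimal_revenue_def by (intro SUP_least) (simp add: mech_revenue_le)

end

section \<open>Thresholds\<close>

text \<open>A union bound: the weight of an element missing from the intersection is charged to some
  \<open>R j\<close> that misses it.\<close>

lemma sum_INT_ge:
  fixes f :: "'a \<Rightarrow> real"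
  assumes fin: "finite K" and Bf: "finite S" and R: "\<And>j. j \<in> K \<Longrightarrow> R j \<subseteq> S" and ne: "K \<noteq> {}"
    and nonneg: "\<And>y. y \<in> S \<Longrightarrow> 0 \<le> f y"
  shows "sum f S - (\<Sum>j\<in>K. sum f S - sum f (R j)) \<le> sum f (\<Inter>j\<in>K. R j)"
proof -
  have sub: "(\<Inter>j\<in>K. R j) \<subseteq> S" using R ne by blast
  have diff: "sum f S - sum f Q = (\<Sum>y\<in>S. if y \<in> Q then 0 else f y)" if "Q \<subseteq> S" for Q
  proof -
    have "sum f S - sum f Q = sum f (S - Q)" using sum_diff[OF Bf that, of f] by simp
    also have "\<dots> = (\<Sum>y\<in>S. if y \<in> Q then 0 else f y)"
      by (rule sum.mono_neutral_cong_left[OF Bf]) auto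
    finally show ?thesis .
  qed
  have "sum f S - sum f (\<Inter>j\<in>K. R j) = (\<Sum>y\<in>S. if y \<in> (\<Inter>j\<in>K. R j) then 0 else f y)"
    by (rule diff[OF sub])
  also have "\<dots> \<le> (\<Sum>y\<in>S. \<Sum>j\<in>K. if y \<in> R j then 0 else f y)"
  proof (rule sum_mono)
    fix y assume y: "y \<in> S"
    have nn: "0 \<le> (if y \<in> R j then 0 else f y)" for j using nonneg[OF y] by simp
    show "(if y \<in> (\<Inter>j\<in>K. R j) then 0 else f y) \<le> (\<Sum>j\<in>K. if y \<in> R j then 0 else f y)"
    proof (cases "y \<in> (\<Inter>j\<in>K. R j)")
      case True
      then show ?thesis by simp
    next
      case False
      then obtain j where j: "j \<in> K" "y \<notin> R j" by auto
      then show ?thesis using False member_le_sum[OF j(1) _ fin, of "\<lambda>j. if y \<in> R j then 0 else f y"] nn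
        by simp
    qed
  qed
  also have "\<dots> = (\<Sum>j\<in>K. \<Sum>y\<in>S. if y \<in> R j then 0 else f y)" by (rule sum.swap)
  also have "\<dots> = (\<Sum>j\<in>K. sum f S - sum f (R j))" by (intro sum.cong refl diff[symmetric] R)
  finally show ?thesis by simp
qed

context bmumd_selection
begin

abbreviation "residual j A s \<equiv> residual_weight (indep E j) (w s) (B s) A"

text \<open>Enlarging an optimal residual set to an inclusion-maximal one loses nothing, because the
  weights on \<open>B s\<close> are nonnegative, and makes it spanning, so that it competes in
  \<open>best_partition\<close>.\<close>

lemma rem_weight_eq:
  assumes j: "j \<in> {1..p}" and A: "A \<in> feasible E" and s: "s \<in> space P"
  shows "rem_weight E B j A s = residual j A s"
proof -
  let ?I = "indep E j" and ?P = "exchange_partition E j A (B s)"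
  let ?f = "\<lambda>(C, R). sum (w s) R"
  have M: "matroid U ?I" by (rule matroids[OF j])
  have AI: "A \<in> ?I" by (rule feasible_indep[OF A j])
  have finB: "finite (B s)" by (rule finite_B[OF s])
  have fin: "finite {z. ?P z}"
    by (rule finite_subset[of _ "Pow (B s) \<times> Pow (B s)"]) (auto simp: exchange_partition_def finB)
  obtain R0 where R0: "R0 \<in> residual_sets ?I (B s) A" "residual j A s = sum (w s) R0"
    by (rule residual_weight_attained[OF finB AI])
  obtain R where R: "R \<in> residual_sets ?I (B s) A" "R0 \<subseteq> R"
    and max: "\<And>R'. R' \<in> residual_sets ?I (B s) A \<Longrightarrow> R \<subseteq> R' \<Longrightarrow> R = R'"
    using finite_has_maximal2[OF finite_residual_sets[OF finB] R0(1)] by auto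
  have R': "R \<subseteq> B s" "A \<inter> R = {}" "A \<union> R \<in> ?I" using R(1) by (auto simp: residual_sets_def)
  have "B s \<subseteq> matroid_cl U ?I (A \<union> R)"
  proof
    fix b assume b: "b \<in> B s"
    have "b \<in> A \<union> R \<or> insert b (A \<union> R) \<notin> ?I"
    proof (rule ccontr)
      assume "\<not> (b \<in> A \<union> R \<or> insert b (A \<union> R) \<notin> ?I)"
      then have "insert b R \<in> residual_sets ?I (B s) A" "b \<notin> R"
        using R' b by (auto simp: residual_sets_def)
      then show False using max[of "insert b R"] by blast
    qed
    moreover have "b \<in> U" using b B_services[OF s] by auto
    ultimately show "b \<in> matroid_cl U ?I (A \<union> R)" using matroid_cl_maximal[OF M R'(3)] by blast
  qed
  then have PR: "?P (B s - R, R)" using R' by (auto simp: exchange_partition_def)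
  define Z where "Z = best_partition E (w s) j (B s) A"
  have Z: "?P Z" "?f (B s - R, R) \<le> ?f Z"
    unfolding Z_def best_partition_def
    using arg_max_finite(1)[of ?P, OF fin PR, of ?f] arg_max_finite(2)[of ?P, OF fin PR PR, of ?f]
    by auto
  have rem: "rem_weight E B j A s = sum (w s) (snd Z)" by (simp add: rem_weight_def Z_def)
  have "snd Z \<in> residual_sets ?I (B s) A"
    using Z(1) by (auto simp: exchange_partition_def residual_sets_def split_beta')
  then have "rem_weight E B j A s \<le> residual j A s" unfolding rem by (rule residual_weight_ge[OF finB])
  moreover have "sum (w s) R0 \<le> sum (w s) R"
    using R(2) R'(1) B_nonneg[OF s] finB by (intro sum_mono2) (auto intro: finite_subset)
  then have "residual j A s \<le> rem_weight E B j A s"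
    using Z(2) unfolding rem R0(2) by (simp add: split_beta')
  ultimately show ?thesis by simp
qed

lemma measurable_residual:
  assumes "A \<in> feasible E" shows "(\<lambda>s. residual j A s) \<in> borel_measurable P"
proof (rule measurable_compose_countable'[where f = "\<lambda>S s. residual_weight (indep E j) (w s) S A",
      OF _ measurable_B])
  fix S assume S: "S \<in> feasible E"
  show "(\<lambda>s. residual_weight (indep E j) (w s) S A) \<in> borel_measurable P"
    unfolding residual_weight_def
  proof (rule borel_measurable_Max)
    show "finite (residual_sets (indep E j) S A)" by (rule finite_residual_sets[OF feasible_finite[OF S]])
    fix R assume "R \<in> residual_sets (indep E j) S A"
    then have "R \<subseteq> U" using feasible_services[OF S] by (auto simp: residual_sets_def)
    then show "(\<lambda>s. sum (w s) R) \<in> borel_measurable P" by (rule measurable_sum_weight)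
  qed
qed (simp add: countable_finite finite_feasible)

lemma residual_bounds:
  assumes "j \<in> {1..p}" "A \<in> feasible E" "s \<in> space P"
  shows "0 \<le> residual j A s" "residual j A s \<le> sum (w s) (B s)"
  using residual_weight_nonneg[OF finite_B[OF assms(3)] feasible_indep[OF assms(2,1)], of "w s"]
    residual_weight_le[OF finite_B[OF assms(3)] feasible_indep[OF assms(2,1)] B_nonneg[OF assms(3)]]
  by auto

lemma integrable_residual:
  assumes "j \<in> {1..p}" "A \<in> feasible E" shows "integrable P (\<lambda>s. residual j A s)"
proof (rule Bochner_Integration.integrable_bound[OF integrable_weight_B measurable_residual[OF assms(2)]])
  show "AE s in P. norm (residual j A s) \<le> norm (sum (w s) (B s))"
  proof (rule AE_I2)
    fix s assume "s \<in> space P"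
    from residual_bounds[OF assms this]
    show "norm (residual j A s) \<le> norm (sum (w s) (B s))" by simp
  qed
qed

section \<open>Expected residual weights and thresholds\<close>

definition residual_mean :: "nat \<Rightarrow> 'u set \<Rightarrow> real" where
  "residual_mean j A = (\<integral>s. residual j A s \<partial>P)"

text \<open>The function \<open>c\<close> of the proof idea at the top.\<close>

definition deficit :: "'u set \<Rightarrow> real" where
  "deficit A = (\<Sum>j=1..p. opt_weight - residual_mean j A)"

abbreviation "T \<equiv> threshold E B"

lemma residual_decrement_mean:
  assumes "j \<in> {1..p}" "A \<in> feasible E" "insert x A \<in> feasible E"
  shows "(\<integral>s. residual j A s - residual j (insert x A) s \<partial>P)
    = residual_mean j A - residual_mean j (insert x A)"
  unfolding residual_mean_def
  using assms by (intro Bochner_Integration.integral_diff integrable_residual)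

text \<open>The second form is what makes the thresholds of the sold services telescope along a
  run.\<close>

lemma threshold_eq:
  assumes A: "insert x A \<in> feasible E"
  shows "T A x = (\<Sum>j=1..p. residual_mean j A - residual_mean j (insert x A)) / (2 * real p)"
    and "T A x = (deficit (insert x A) - deficit A) / (2 * real p)"
proof -
  have A': "A \<in> feasible E" by (rule feasible_subset[OF A]) auto
  have "(\<integral>s. (rem_weight E B j A s - rem_weight E B j (insert x A) s) \<partial>P)
      = residual_mean j A - residual_mean j (insert x A)" if j: "j \<in> {1..p}" for j
  proof -
    have "(\<integral>s. (rem_weight E B j A s - rem_weight E B j (insert x A) s) \<partial>P)
        = (\<integral>s. residual j A s - residual j (insert x A) s \<partial>P)"
      by (intro Bochner_Integration.integral_cong refl) (simp add: rem_weight_eq[OF j] A A')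
    then show ?thesis using residual_decrement_mean[OF j A' A] by simp
  qed
  then have "(\<Sum>j=1..p. \<integral>s. (rem_weight E B j A s - rem_weight E B j (insert x A) s) \<partial>P)
      = (\<Sum>j=1..p. residual_mean j A - residual_mean j (insert x A))"
    by (rule sum.cong[OF refl])
  then show eq: "T A x = (\<Sum>j=1..p. residual_mean j A - residual_mean j (insert x A)) / (2 * real p)"
    by (simp add: threshold_def)
  show "T A x = (deficit (insert x A) - deficit A) / (2 * real p)"
    unfolding eq deficit_def sum_subtractf[symmetric] by simp
qed

text \<open>Submodularity gives the inequality for each sample and each matroid; averaging keeps
  it.\<close>

lemma threshold_mono:
  assumes A': "insert x A' \<in> feasible E" and sub: "A \<subseteq> A'" and x: "x \<notin> A'"
  shows "T A x \<le> T A' x"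
proof -
  have A: "insert x A \<in> feasible E" by (rule feasible_subset[OF A']) (use sub in auto)
  have F: "A \<in> feasible E" "A' \<in> feasible E" by (rule feasible_subset[OF A'], use sub in blast)+
  have "residual_mean j A - residual_mean j (insert x A)
      \<le> residual_mean j A' - residual_mean j (insert x A')" if j: "j \<in> {1..p}" for j
    unfolding residual_decrement_mean[OF j F(1) A, symmetric] residual_decrement_mean[OF j F(2) A', symmetric]
    using j A A' F
    by (intro integral_mono Bochner_Integration.integrable_diff integrable_residual)
      (simp_all add: residual_weight_decrement_mono[OF matroids[OF j] finite_B feasible_indep[OF A' j] sub x])
  then show ?thesis
    unfolding threshold_eq(1)[OF A] threshold_eq(1)[OF A'] by (intro divide_right_mono sum_mono) auto
qed

text \<open>For each matroid and each sample the decrements over \<open>V\<close> sum to at most the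
  residual weight of \<open>A\<close>; the mean residual weights add up to
  \<open>real p * opt_weight - deficit A\<close>.\<close>

lemma sum_threshold_le:
  assumes AV: "A \<union> V \<in> feasible E" and disj: "A \<inter> V = {}"
  shows "(\<Sum>x\<in>V. T A x) \<le> (real p * opt_weight - deficit A) / (2 * real p)"
proof -
  have A: "A \<in> feasible E" by (rule feasible_subset[OF AV]) auto
  have Ax: "insert x A \<in> feasible E" if "x \<in> V" for x by (rule feasible_subset[OF AV]) (use that in auto)
  have "(\<Sum>x\<in>V. residual_mean j A - residual_mean j (insert x A)) \<le> residual_mean j A"
    if j: "j \<in> {1..p}" for j
  proof -
    have int: "integrable P (\<lambda>s. residual j A s - residual j (insert x A) s)" if "x \<in> V" for x
      by (intro Bochner_Integration.integrable_diff integrable_residual j A Ax that)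
    have "(\<Sum>x\<in>V. residual_mean j A - residual_mean j (insert x A))
        = (\<Sum>x\<in>V. \<integral>s. residual j A s - residual j (insert x A) s \<partial>P)"
      by (intro sum.cong refl residual_decrement_mean[symmetric] j A Ax)
    also have "\<dots> = (\<integral>s. (\<Sum>x\<in>V. residual j A s - residual j (insert x A) s) \<partial>P)"
      by (rule Bochner_Integration.integral_sum[symmetric]) (rule int)
    also have "\<dots> \<le> residual_mean j A"
      unfolding residual_mean_def
    proof (rule integral_mono[OF _ integrable_residual[OF j A]])
      show "integrable P (\<lambda>s. \<Sum>x\<in>V. residual j A s - residual j (insert x A) s)"
        by (rule Bochner_Integration.integrable_sum) (rule int)
      show "(\<Sum>x\<in>V. residual j A s - residual j (insert x A) s) \<le> residual j A s" if "s \<in> space P" for s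
        by (rule residual_weight_decrement_sum[OF matroids[OF j] finite_B[OF that] feasible_indep[OF AV j] disj])
    qed
    finally show ?thesis .
  qed
  then have "(\<Sum>j=1..p. \<Sum>x\<in>V. residual_mean j A - residual_mean j (insert x A))
      \<le> (\<Sum>j=1..p. residual_mean j A)"
    by (rule sum_mono)
  also have "\<dots> = real p * opt_weight - deficit A" by (simp add: deficit_def sum_subtractf)
  finally have "(\<Sum>x\<in>V. \<Sum>j=1..p. residual_mean j A - residual_mean j (insert x A))
      \<le> real p * opt_weight - deficit A"
    by (subst sum.swap)
  moreover have "(\<Sum>x\<in>V. T A x)
      = (\<Sum>x\<in>V. \<Sum>j=1..p. residual_mean j A - residual_mean j (insert x A)) / (2 * real p)"
    by (subst sum_divide_distrib) (intro sum.cong refl threshold_eq(1) Ax)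
  ultimately show ?thesis by (simp add: divide_right_mono)
qed

lemma deficit_empty: "deficit {} = 0"
proof -
  have "residual_mean j {} = opt_weight" if j: "j \<in> {1..p}" for j
    unfolding residual_mean_def opt_weight_def
  proof (intro Bochner_Integration.integral_cong refl)
    fix s assume s: "s \<in> space P"
    show "residual j {} s = sum (w s) (B s)"
      by (rule residual_weight_empty[OF finite_B[OF s] feasible_indep[OF B_feasible[OF s] j]
            feasible_indep[OF empty_feasible j] B_nonneg[OF s]])
  qed
  then show ?thesis by (simp add: deficit_def)
qed

text \<open>By \<open>virtual_inv_cases\<close>, when \<open>x\<close> can be added to
  \<open>A\<close> this is the expected revenue beyond the threshold from offering \<open>x\<close>
  alone at its price.\<close>

definition excess :: "'u set \<Rightarrow> 'u \<Rightarrow> real" where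
  "excess A x = (\<integral>s. max 0 (w s x - T A x) \<partial>P)"

lemma excess_eq:
  assumes x: "x \<in> U"
  shows "excess A x = (\<integral>t. max 0 (virtual_value (dens E x) t - T A x) \<partial>D x)"
    and "integrable P (\<lambda>s. max 0 (w s x - T A x))"
proof -
  interpret R: regular_dist "dens E x" by (rule regular_dist[OF x])
  show "excess A x = (\<integral>t. max 0 (virtual_value (dens E x) t - T A x) \<partial>D x)"
    unfolding excess_def weight_def by (rule integral_component[OF x]) simp
  show "integrable P (\<lambda>s. max 0 (w s x - T A x))"
    unfolding weight_def by (rule integrable_component[OF x R.integrable_pos_part])
qed

lemma excess_nonneg: "0 \<le> excess A x"
  unfolding excess_def by simp

lemma excess_antimono:
  assumes x: "x \<in> U" and T: "T A x \<le> T A' x" shows "excess A' x \<le> excess A x"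
  unfolding excess_def using T by (intro integral_mono excess_eq(2)[OF x]) auto

definition addable :: "'u set \<Rightarrow> 'u set" where
  "addable A = {x \<in> U. x \<notin> A \<and> insert x A \<in> feasible E}"

text \<open>For a fixed sample, the intersection \<open>V\<close> of optimal residual sets of all
  matroids can be added to \<open>A\<close> as a whole. Its weight is bounded below by
  \<open>sum_INT_ge\<close> and its thresholds above by \<open>sum_threshold_le\<close>; the claim
  follows from the expectation of the difference.\<close>

lemma sum_excess_ge:
  assumes A: "A \<in> feasible E"
  shows "opt_weight / 2 - deficit A * (1 - 1 / (2 * real p)) \<le> (\<Sum>x\<in>addable A. excess A x)"
proof -
  define K where "K = (real p * opt_weight - deficit A) / (2 * real p)"
  have fX: "finite (addable A)" by (rule finite_subset[of _ U]) (auto simp: addable_def)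
  have pw: "sum (w s) (B s) - (\<Sum>j=1..p. sum (w s) (B s) - residual j A s) - K
      \<le> (\<Sum>x\<in>addable A. max 0 (w s x - T A x))" if s: "s \<in> space P" for s
  proof -
    have "\<exists>R. R \<in> residual_sets (indep E j) (B s) A \<and> residual j A s = sum (w s) R" if j: "j \<in> {1..p}" for j
      using residual_weight_attained[OF finite_B[OF s] feasible_indep[OF A j]] by metis
    then obtain R where R: "\<And>j. j \<in> {1..p} \<Longrightarrow> R j \<in> residual_sets (indep E j) (B s) A"
        "\<And>j. j \<in> {1..p} \<Longrightarrow> residual j A s = sum (w s) (R j)"
      by metis
    have R': "R j \<subseteq> B s" "A \<inter> R j = {}" "A \<union> R j \<in> indep E j" if "j \<in> {1..p}" for j
      using R(1)[OF that] by (auto simp: residual_sets_def)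
    define V where "V = (\<Inter>j\<in>{1..p}. R j)"
    have ne: "{1..p} \<noteq> {}" and 1: "1 \<in> {1..p}" using p_pos by auto
    have V: "A \<union> V \<in> feasible E"
      unfolding feasible_def
    proof
      fix j assume j: "j \<in> {1..p}"
      show "A \<union> V \<in> indep E j"
        by (rule matroid_subset[OF matroids[OF j] R'(3)[OF j]]) (use j in \<open>auto simp: V_def\<close>)
    qed
    have AV: "A \<inter> V = {}" using R'(2)[OF 1] 1 unfolding V_def by blast
    have "V \<subseteq> addable A"
    proof
      fix x assume x: "x \<in> V"
      have "insert x A \<in> feasible E" by (rule feasible_subset[OF V]) (use x in auto)
      then show "x \<in> addable A" using x AV feasible_services[OF V] by (auto simp: addable_def)
    qed
    then have "(\<Sum>x\<in>V. max 0 (w s x - T A x)) \<le> (\<Sum>x\<in>addable A. max 0 (w s x - T A x))"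
      using fX by (intro sum_mono2) auto
    moreover have "sum (w s) V - (\<Sum>x\<in>V. T A x) \<le> (\<Sum>x\<in>V. max 0 (w s x - T A x))"
      unfolding sum_subtractf[symmetric] by (intro sum_mono) auto
    \<comment> \<open>\<open>V\<close> varies with \<open>s\<close>, while the thresholds are
      already averaged over a separate sample and are constants here, so the bound \<open>K\<close>
      serves every \<open>s\<close>.\<close>
    moreover have "(\<Sum>x\<in>V. T A x) \<le> K" unfolding K_def by (rule sum_threshold_le[OF V AV])
    moreover have "sum (w s) (B s) - (\<Sum>j=1..p. sum (w s) (B s) - sum (w s) (R j)) \<le> sum (w s) V"
      unfolding V_def by (rule sum_INT_ge[OF _ finite_B[OF s] R'(1) ne B_nonneg[OF s]]) auto
    moreover have "(\<Sum>j=1..p. sum (w s) (B s) - residual j A s)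
        = (\<Sum>j=1..p. sum (w s) (B s) - sum (w s) (R j))"
      by (intro sum.cong refl) (simp add: R(2))
    ultimately show ?thesis by simp
  qed
  have int: "integrable P (\<lambda>s. sum (w s) (B s) - residual j A s)" if "j \<in> {1..p}" for j
    by (intro Bochner_Integration.integrable_diff integrable_weight_B integrable_residual that A)
  have intl: "(\<integral>s. sum (w s) (B s) - residual j A s \<partial>P) = opt_weight - residual_mean j A"
    if "j \<in> {1..p}" for j
    unfolding opt_weight_def residual_mean_def
    by (intro Bochner_Integration.integral_diff integrable_weight_B integrable_residual that A)
  have int2: "integrable P (\<lambda>s. \<Sum>j=1..p. sum (w s) (B s) - residual j A s)"
    by (rule Bochner_Integration.integrable_sum) (rule int)
  have int3: "integrable P (\<lambda>s. sum (w s) (B s) - (\<Sum>j=1..p. sum (w s) (B s) - residual j A s))"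
    by (rule Bochner_Integration.integrable_diff[OF integrable_weight_B int2])
  have "(\<integral>s. (\<Sum>j=1..p. sum (w s) (B s) - residual j A s) \<partial>P) = deficit A"
    unfolding deficit_def using int intl by (subst Bochner_Integration.integral_sum) auto
  then have "(\<integral>s. sum (w s) (B s) - (\<Sum>j=1..p. sum (w s) (B s) - residual j A s) - K \<partial>P)
      = opt_weight - deficit A - K"
    using Bochner_Integration.integral_diff[OF int3, of "\<lambda>_. K"]
      Bochner_Integration.integral_diff[OF integrable_weight_B int2]
    by (simp add: opt_weight_def prob_space)
  moreover have "(\<integral>s. sum (w s) (B s) - (\<Sum>j=1..p. sum (w s) (B s) - residual j A s) - K \<partial>P)
      \<le> (\<integral>s. (\<Sum>x\<in>addable A. max 0 (w s x - T A x)) \<partial>P)"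
  proof (rule integral_mono[OF _ _ pw])
    show "integrable P (\<lambda>s. sum (w s) (B s) - (\<Sum>j=1..p. sum (w s) (B s) - residual j A s) - K)"
      by (rule Bochner_Integration.integrable_diff[OF int3]) simp
    show "integrable P (\<lambda>s. \<Sum>x\<in>addable A. max 0 (w s x - T A x))"
      by (intro Bochner_Integration.integrable_sum excess_eq(2)) (simp add: addable_def)
  qed
  moreover have "(\<integral>s. (\<Sum>x\<in>addable A. max 0 (w s x - T A x)) \<partial>P) = (\<Sum>x\<in>addable A. excess A x)"
    unfolding excess_def
    by (intro Bochner_Integration.integral_sum excess_eq(2)) (auto simp: addable_def)
  moreover have "opt_weight - deficit A - K = opt_weight / 2 - deficit A * (1 - 1 / (2 * real p))"
    using p_pos by (simp add: K_def field_simps)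
  ultimately show ?thesis by simp
qed

end

section \<open>The run of the mechanism\<close>

locale bmumd_choice = bmumd_selection E B for E :: "'u bmumd" and B +
  fixes ch :: "nat \<Rightarrow> 'u set \<Rightarrow> ('u \<Rightarrow> real) \<Rightarrow> 'u option"
  assumes choice: "choice_rule E B ch"
begin

abbreviation "price \<equiv> posted_price E B"
abbreviation "rprice A x \<equiv> real_of_ereal (price A x)"
abbreviation "sold k v \<equiv> fst (run E B ch v k)"

text \<open>An infinite price comes either from infeasibility or from virtual values that never
  reach the threshold; in the second case the excess vanishes.\<close>

lemma price_cases:
  assumes x: "x \<in> U"
  obtains (none) "price A x = \<infinity>" "insert x A \<in> feasible E \<Longrightarrow> excess A x = 0"
  | (price) r where "insert x A \<in> feasible E" "price A x = ereal r" "T A x \<le> r"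
      "excess A x = (r - T A x) * measure (D x) {r<..}"
proof (cases "insert x A \<in> feasible E")
  case True
  then have eq: "price A x = virtual_inv (dens E x) (T A x)" by (simp add: posted_price_def)
  from regular_dist[OF x] show thesis
    by (rule regular_dist.virtual_inv_cases[of _ "T A x"])
      (use eq True excess_eq(1)[OF x, of A] in \<open>auto intro: none price\<close>)
next
  case False
  then show thesis by (intro none) (simp_all add: posted_price_def)
qed

lemma measurable_choice:
  "i \<in> {1..n} \<Longrightarrow> A \<in> feasible E \<Longrightarrow> ch i A \<in> measurable P (count_space UNIV)"
  using choice unfolding choice_rule_def by blast

lemma choice_max:
  assumes "i \<in> {1..n}" "A \<in> feasible E" "v \<in> space P"
  shows "is_arg_max (buyer_utility (price A) v) (\<lambda>c. c \<in> insert None (Some ` J i)) (ch i A v)"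
  using choice assms unfolding choice_rule_def by blast

lemma choice_range:
  assumes "i \<in> {1..n}" "A \<in> feasible E" "v \<in> space P"
  shows "ch i A v \<in> insert None (Some ` J i)"
    and "c \<in> insert None (Some ` J i) \<Longrightarrow>
      buyer_utility (price A) v c \<le> buyer_utility (price A) v (ch i A v)"
  using choice_max[OF assms] unfolding is_arg_max_linorder by blast+

text \<open>Buying nothing has utility 0, so a chosen service has a finite price; by
  \<open>price_cases\<close> this implies feasibility and a price at or above the threshold.\<close>

lemma chosen:
  assumes i: "i \<in> {1..n}" and A: "A \<in> feasible E" and v: "v \<in> space P" and c: "ch i A v = Some x"
  shows "x \<in> J i" "x \<in> U" "insert x A \<in> feasible E" "price A x \<noteq> \<infinity>"
    "T A x \<le> rprice A x" "buyer_utility (price A) u (Some x) = ereal (u x - rprice A x)"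
proof -
  show x: "x \<in> J i" using choice_range(1)[OF i A v] c by auto
  then show xU: "x \<in> U" using J_subset[OF i] by auto
  have "0 \<le> ereal (v x) - price A x"
    using choice_range(2)[OF i A v, of None] c by (simp add: buyer_utility_def)
  then show fin: "price A x \<noteq> \<infinity>" by auto
  obtain r where "insert x A \<in> feasible E" "price A x = ereal r" "T A x \<le> r"
    using price_cases[OF xU, of A] fin by metis
  then show "insert x A \<in> feasible E" "T A x \<le> rprice A x"
    "buyer_utility (price A) u (Some x) = ereal (u x - rprice A x)"
    by (simp_all add: buyer_utility_def)
qed

section \<open>The set sold after the first bidders\<close>

lemma sold_Suc:
  "sold (Suc k) v = (case ch (Suc k) (sold k v) v of None \<Rightarrow> sold k v | Some x \<Rightarrow> insert x (sold k v))"
  by (simp add: Let_def split_beta' split: option.split)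

lemma payments_Suc:
  "snd (run E B ch v (Suc k)) = snd (run E B ch v k)
    + (case ch (Suc k) (sold k v) v of None \<Rightarrow> 0 | Some x \<Rightarrow> rprice (sold k v) x)"
  by (simp add: Let_def split_beta' split: option.split)

lemma sold_feasible: "k \<le> n \<Longrightarrow> v \<in> space P \<Longrightarrow> sold k v \<in> feasible E"
proof (induction k)
  case 0
  then show ?case by (simp add: empty_feasible)
next
  case (Suc k)
  then have A: "sold k v \<in> feasible E" and k: "Suc k \<in> {1..n}" by auto
  show ?case
  proof (cases "ch (Suc k) (sold k v) v")
    case None
    then show ?thesis unfolding sold_Suc using A by simp
  next
    case (Some x)
    then show ?thesis unfolding sold_Suc using chosen(3)[OF k A Suc.prems(2) Some] by simp
  qed
qed

lemma sold_mono: "k \<le> l \<Longrightarrow> sold k v \<subseteq> sold l v"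
proof (induction l rule: dec_induct)
  case (step l)
  then show ?case unfolding sold_Suc by (auto split: option.split)
qed simp

text \<open>Choices are measurable for each fixed set \<open>A\<close> already sold, so the finitely
  many possible sets are treated separately.\<close>

lemma measurable_sold: "k \<le> n \<Longrightarrow> sold k \<in> measurable P (count_space (feasible E))"
proof (induction k)
  case 0
  show ?case by (simp add: empty_feasible)
next
  case (Suc k)
  then have k: "Suc k \<in> {1..n}" by auto
  have "sold (Suc k) \<in> measurable P (count_space UNIV)"
    unfolding sold_Suc
  proof (rule measurable_compose_countable'[where f = "\<lambda>A v. case ch (Suc k) A v of None \<Rightarrow> A | Some x \<Rightarrow> insert x A"])
    fix A assume A: "A \<in> feasible E"
    show "(\<lambda>v. case ch (Suc k) A v of None \<Rightarrow> A | Some x \<Rightarrow> insert x A) \<in> measurable P (count_space UNIV)"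
      using measurable_compose[OF measurable_choice[OF k A],
          of "\<lambda>c. case c of None \<Rightarrow> A | Some x \<Rightarrow> insert x A" "count_space UNIV"] by simp
  qed (use Suc in \<open>simp_all add: countable_finite finite_feasible\<close>)
  then show ?case by (rule measurable_feasible) (rule sold_feasible[OF Suc.prems])
qed

text \<open>The choice rule may look at the whole profile to break ties; off the null set of tied profiles
  the choice of a bidder depends on his own values only.\<close>

definition tied :: "('u \<Rightarrow> real) \<Rightarrow> bool" where
  "tied v \<longleftrightarrow> (\<exists>A\<in>feasible E. \<exists>x\<in>U. v x = rprice A x \<or>
     (\<exists>y\<in>U. y \<noteq> x \<and> v x - v y = rprice A x - rprice A y))"

lemma AE_not_tied: "AE v in P. \<not> tied v"
proof -
  have "AE v in P. \<forall>A\<in>feasible E. \<forall>x\<in>U. v x \<noteq> rprice A x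
      \<and> (\<forall>y\<in>U. y \<noteq> x \<longrightarrow> v x - v y \<noteq> rprice A x - rprice A y)"
  proof (intro AE_finite_allI finite_feasible finite_U AE_conjI)
    fix A x y assume "x \<in> U" "y \<in> U"
    then show "AE v in P. y \<noteq> x \<longrightarrow> v x - v y \<noteq> rprice A x - rprice A y"
      using AE_component_diff_neq[of x y] by (cases "y = x") auto
  qed (rule AE_component_neq)
  then show ?thesis by eventually_elim (auto simp: tied_def)
qed

text \<open>Both choices maximize the same utility, so two different ones would be a tie at
  \<open>v\<close>. Their prices are finite by \<open>chosen\<close>, which allows the comparison in
  the reals.\<close>

lemma choice_unique:
  assumes i: "i \<in> {1..n}" and A: "A \<in> feasible E" and vv: "v \<in> space P" "v' \<in> space P"
    and tie: "\<not> tied v" and eq: "\<And>y. y \<in> J i \<Longrightarrow> v y = v' y"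
  shows "ch i A v = ch i A v'"
proof (rule ccontr)
  assume neq: "ch i A v \<noteq> ch i A v'"
  let ?u = "buyer_utility (price A)"
  have u: "?u v c = ?u v' c" if "c \<in> insert None (Some ` J i)" for c
    using that eq by (auto simp: buyer_utility_def)
  have "?u v (ch i A v) \<le> ?u v (ch i A v')"
    using choice_range(2)[OF i A vv(2) choice_range(1)[OF i A vv(1)]]
    by (simp only: u[OF choice_range(1)[OF i A vv(1)]] u[OF choice_range(1)[OF i A vv(2)]])
  moreover have "?u v (ch i A v') \<le> ?u v (ch i A v)"
    by (rule choice_range(2)[OF i A vv(1) choice_range(1)[OF i A vv(2)]])
  ultimately have same: "?u v (ch i A v) = ?u v (ch i A v')" by (rule antisym)
  have eq0: "v x \<noteq> rprice A x" if "x \<in> U" for x using tie A that unfolding tied_def by blast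
  have None_eq: "?u v None = ereal 0" by (simp add: buyer_utility_def)
  show False
  proof (cases "ch i A v")
    case None
    then obtain x where x: "ch i A v' = Some x" using neq by (cases "ch i A v'") auto
    have "ereal (v x - rprice A x) = ereal 0"
      using same unfolding None x None_eq chosen(6)[OF i A vv(2) x, of v] by (rule sym)
    then show False using eq0[OF chosen(2)[OF i A vv(2) x]] by simp
  next
    case cx: (Some x)
    show False
    proof (cases "ch i A v'")
      case None
      have "ereal (v x - rprice A x) = ereal 0"
        using same unfolding None cx None_eq chosen(6)[OF i A vv(1) cx, of v] .
      then show False using eq0[OF chosen(2)[OF i A vv(1) cx]] by simp
    next
      case cy: (Some y)
      have "ereal (v x - rprice A x) = ereal (v y - rprice A y)"
        using same unfolding cx cy chosen(6)[OF i A vv(1) cx, of v] chosen(6)[OF i A vv(2) cy, of v] .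
      then have "v x - v y = rprice A x - rprice A y" by simp
      moreover have "y \<noteq> x" using neq cx cy by auto
      ultimately show False
        using tie A chosen(2)[OF i A vv(1) cx] chosen(2)[OF i A vv(2) cy] unfolding tied_def by blast
    qed
  qed
qed

text \<open>Only \<open>v\<close> has to be untied: in \<open>sale_probability\<close> the profile
  \<open>v'\<close> arises by changing a value of a later bidder and may be tied.\<close>

lemma sold_cong:
  assumes "k \<le> n" "v \<in> space P" "v' \<in> space P" "\<not> tied v"
    and "\<And>i y. i \<in> {1..k} \<Longrightarrow> y \<in> J i \<Longrightarrow> v y = v' y"
  shows "sold k v = sold k v'"
  using assms(1,5)
proof (induction k)
  case 0
  show ?case by simp
next
  case (Suc k)
  have IH: "sold k v = sold k v'"
  proof (rule Suc.IH)
    show "v y = v' y" if "i \<in> {1..k}" "y \<in> J i" for i y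
      by (rule Suc.prems(2)[of i]) (use that in simp_all)
  qed (use Suc.prems(1) in simp)
  have A: "sold k v \<in> feasible E" using Suc.prems(1) by (intro sold_feasible assms) auto
  have "ch (Suc k) (sold k v) v = ch (Suc k) (sold k v) v'"
  proof (rule choice_unique[OF _ A assms(2,3,4)])
    show "v y = v' y" if "y \<in> J (Suc k)" for y
      by (rule Suc.prems(2)[of "Suc k"]) (use that in simp_all)
  qed (use Suc.prems(1) in simp)
  then show ?case unfolding sold_Suc IH[symmetric] by simp
qed

text \<open>If nothing is bought then no other service of the bidder is worth its price. That event does
  not depend on the value of \<open>x\<close>, and together with a value of \<open>x\<close> above its price it forces the
  sale of \<open>x\<close>.\<close>

lemma sale_probability:
  assumes k: "k < n" and A: "A \<in> feasible E" and x: "x \<in> J (Suc k)" and r: "price A x = ereal r"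
  shows "prob {v \<in> space P. sold k v = A \<and> ch (Suc k) A v = None} * measure (D x) {r<..}
    \<le> prob {v \<in> space P. sold k v = A \<and> ch (Suc k) A v = Some x}"
proof -
  have i: "Suc k \<in> {1..n}" using k by simp
  have xU: "x \<in> U" using J_subset[OF i] x by auto
  interpret R: regular_dist "dens E x" by (rule regular_dist[OF xU])
  define Q where "Q v \<longleftrightarrow> sold k v = A \<and> (\<forall>y\<in>J (Suc k). y \<noteq> x \<longrightarrow> ereal (v y) \<le> price A y)" for v
  have [measurable]: "Measurable.pred P (\<lambda>v. sold k v = A)"
    using measurable_compose[OF measurable_sold[of k], of "\<lambda>S. S = A" "count_space UNIV"] k by simp
  have chm: "Measurable.pred P (\<lambda>v. ch (Suc k) A v = c)" for c
    using measurable_compose[OF measurable_choice[OF i A], of "\<lambda>d. d = c" "count_space UNIV"] by simp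
  note [measurable] = chm
  have [measurable]: "(\<lambda>v. v y) \<in> borel_measurable P" if "y \<in> J (Suc k)" for y
    using that J_subset[OF i] by (intro measurable_component) auto
  have [measurable]: "Measurable.pred P (\<lambda>v. \<forall>y\<in>J (Suc k). y \<noteq> x \<longrightarrow> ereal (v y) \<le> price A y)"
  proof (rule pred_intros_finite(3)[OF finite_J[OF i]])
    fix y assume "y \<in> J (Suc k)"
    then have [measurable]: "(\<lambda>v. v y) \<in> borel_measurable P" using J_subset[OF i] by (intro measurable_component) auto
    show "Measurable.pred P (\<lambda>v. y \<noteq> x \<longrightarrow> ereal (v y) \<le> price A y)" by measurable
  qed
  have Q [measurable]: "Measurable.pred P Q" unfolding Q_def by measurable
  have [measurable]: "(\<lambda>v. v x) \<in> borel_measurable P" by (rule measurable_component[OF xU])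
  have choice_None: "Q v" if "v \<in> space P" "sold k v = A" "ch (Suc k) A v = None" for v
  proof -
    have "ereal (v y) \<le> price A y" if y: "y \<in> J (Suc k)" for y
    proof -
      have yU: "y \<in> U" using y J_subset[OF i] by auto
      have "ereal (v y) - price A y \<le> 0"
        using choice_range(2)[OF i A \<open>v \<in> space P\<close>, of "Some y"] y \<open>ch (Suc k) A v = None\<close>
        by (simp add: buyer_utility_def)
      then show ?thesis by (cases "price A y") (simp_all add: zero_ereal_def)
    qed
    then show ?thesis using that by (simp add: Q_def)
  qed
  \<comment> \<open>\<open>x\<close> has positive utility, so something is bought, and under
    \<open>Q\<close> no other service has positive utility.\<close>
  have choice_Some: "ch (Suc k) A v = Some x" if v: "v \<in> space P" and "Q v" "r < v x" for v
  proof -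
    let ?c = "ch (Suc k) A v"
    have "0 < ereal (v x) - price A x" using that r by (simp add: zero_ereal_def)
    also have "\<dots> \<le> buyer_utility (price A) v ?c"
      using choice_range(2)[OF i A v, of "Some x"] x by (simp add: buyer_utility_def)
    finally have pos: "0 < buyer_utility (price A) v ?c" .
    then obtain y where y: "?c = Some y" by (cases ?c) (auto simp: buyer_utility_def)
    note cy = chosen[OF i A v y]
    have "\<not> ereal (v y) \<le> price A y"
      using pos cy(4) unfolding y buyer_utility_def
      by (cases "price A y") (simp_all add: zero_ereal_def)
    then have "y = x" using \<open>Q v\<close> cy(1) by (auto simp: Q_def)
    then show ?thesis using y by simp
  qed
  have "prob {v \<in> space P. sold k v = A \<and> ch (Suc k) A v = None} * R.prob {r<..}
      \<le> prob {v \<in> space P. Q v} * R.prob {r<..}"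
    using choice_None by (intro mult_right_mono finite_measure_mono) auto
  also have "\<dots> = (\<integral>v. indicator {v \<in> space P. Q v} v * R.prob {r<..} \<partial>P)" by simp
  \<comment> \<open>Resampling the value of \<open>x\<close> leaves \<open>Q\<close> unchanged off
    the null set of ties, so the inner integral factors into the indicator of \<open>Q\<close> and
    the probability of exceeding \<open>r\<close>.\<close>
  also have "\<dots> = (\<integral>v. (\<integral>t. indicator {v \<in> space P. Q v \<and> r < v x} (v(x := t)) \<partial>D x) \<partial>P)"
  proof (rule integral_cong_AE)
    have "integrable P (indicator {v \<in> space P. Q v \<and> r < v x} :: _ \<Rightarrow> real)"
      by (rule integrable_real_indicator) (auto simp: emeasure_eq_measure)
    from integral_resample(2)[OF xU this]
    show "(\<lambda>v. \<integral>t. indicat_real {v \<in> space P. Q v \<and> r < v x} (v(x := t)) \<partial>D x) \<in> borel_measurable P"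
      by (rule borel_measurable_integrable)
    show "AE v in P. indicator {v \<in> space P. Q v} v * R.prob {r<..}
        = (\<integral>t. indicator {v \<in> space P. Q v \<and> r < v x} (v(x := t)) \<partial>D x)"
      using AE_not_tied AE_space
    proof eventually_elim
      case (elim v)
      have sp: "v(x := t) \<in> space P" for t
        using elim(2) xU by (auto simp: value_law_def space_PiM PiE_iff extensional_def)
      have "sold k v = sold k (v(x := t))" for t
      proof (rule sold_cong[OF _ elim(2) sp elim(1)])
        fix l y assume l: "l \<in> {1..k}" "y \<in> J l"
        then have "l \<in> {1..n}" using k by auto
        then have "y \<noteq> x" using J_unique[OF _ i l(2), of] x l by auto
        then show "v y = (v(x := t)) y" by simp
      qed (use k in simp)
      then have "Q (v(x := t)) = Q v" for t by (simp add: Q_def)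
      then have "(\<integral>t. indicat_real {v \<in> space P. Q v \<and> r < v x} (v(x := t)) \<partial>D x)
          = (\<integral>t. indicat_real {v \<in> space P. Q v} v * indicat_real {r<..} t \<partial>D x)"
        using sp elim(2) by (intro Bochner_Integration.integral_cong refl) (auto split: split_indicator)
      then show ?case by simp
    qed
  qed simp
  also have "\<dots> = (\<integral>v. indicator {v \<in> space P. Q v \<and> r < v x} v \<partial>P)"
    by (rule integral_resample(1)[OF xU, symmetric], rule integrable_real_indicator)
      (auto simp: emeasure_eq_measure)
  also have "\<dots> = prob {v \<in> space P. Q v \<and> r < v x}"
  proof -
    have "{v \<in> space P. Q v \<and> r < v x} \<inter> space P = {v \<in> space P. Q v \<and> r < v x}" by auto
    then show ?thesis by simp
  qed
  also have "\<dots> \<le> prob {v \<in> space P. sold k v = A \<and> ch (Suc k) A v = Some x}"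
    using choice_Some by (intro finite_measure_mono) (auto simp: Q_def)
  finally show ?thesis .
qed

text \<open>Index \<open>k\<close> belongs to bidder \<open>Suc k\<close>, who faces the set sold to
  the first \<open>k\<close> bidders; what is counted is the revenue beyond the threshold.\<close>

definition gain :: "nat \<Rightarrow> ('u \<Rightarrow> real) \<Rightarrow> real" where
  "gain k v = (case ch (Suc k) (sold k v) v of None \<Rightarrow> 0
     | Some x \<Rightarrow> rprice (sold k v) x - T (sold k v) x)"

text \<open>A lower bound, in expectation, of the gain from a bidder, paid out on the complementary event
  that he buys nothing.\<close>

definition reserve :: "nat \<Rightarrow> ('u \<Rightarrow> real) \<Rightarrow> real" where
  "reserve k v = (if ch (Suc k) (sold k v) v = None
     then \<Sum>x\<in>{x \<in> J (Suc k). insert x (sold k v) \<in> feasible E}. excess (sold k v) x else 0)"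

text \<open>Each sale raises \<open>deficit\<close> by \<open>2 * real p\<close> times its
  threshold, so the thresholds of all sales add up to the first summand.\<close>

lemma payments_eq:
  assumes "k \<le> n" "v \<in> space P"
  shows "snd (run E B ch v k) = deficit (sold k v) / (2 * real p) + (\<Sum>l<k. gain l v)"
  using assms(1)
proof (induction k)
  case 0
  show ?case by (simp add: deficit_empty)
next
  case (Suc k)
  then have i: "Suc k \<in> {1..n}" and A: "sold k v \<in> feasible E"
    using sold_feasible[OF _ assms(2)] by auto
  show ?case
  proof (cases "ch (Suc k) (sold k v) v")
    case None
    then have "snd (run E B ch v (Suc k)) = snd (run E B ch v k)" "sold (Suc k) v = sold k v" "gain k v = 0"
      unfolding payments_Suc sold_Suc gain_def by simp_all
    then show ?thesis using Suc.IH Suc.prems by simp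
  next
    case (Some x)
    have "T (sold k v) x = deficit (insert x (sold k v)) / (2 * real p) - deficit (sold k v) / (2 * real p)"
      using threshold_eq(2)[OF chosen(3)[OF i A assms(2) Some]] by (simp add: diff_divide_distrib)
    moreover have "snd (run E B ch v (Suc k)) = snd (run E B ch v k) + rprice (sold k v) x"
        "sold (Suc k) v = insert x (sold k v)" "gain k v = rprice (sold k v) x - T (sold k v) x"
      unfolding payments_Suc sold_Suc gain_def using Some by simp_all
    ultimately show ?thesis using Suc.IH Suc.prems by simp
  qed
qed

lemma gain_nonneg: "k < n \<Longrightarrow> v \<in> space P \<Longrightarrow> 0 \<le> gain k v"
  using chosen(5)[of "Suc k" "sold k v" v] sold_feasible[of k v]
  by (auto simp: gain_def split: option.split)

section \<open>Expected gain and expected reserve\<close>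

lemma sets_choice:
  assumes k: "k < n" and A: "A \<in> feasible E"
  shows "{v \<in> space P. sold k v = A \<and> ch (Suc k) A v = c} \<in> sets P"
proof -
  have i: "Suc k \<in> {1..n}" using k by simp
  have [measurable]: "Measurable.pred P (\<lambda>v. sold k v = A)"
    using measurable_compose[OF measurable_sold[of k], of "\<lambda>S. S = A" "count_space UNIV"] k by simp
  have [measurable]: "Measurable.pred P (\<lambda>v. ch (Suc k) A v = c)"
    using measurable_compose[OF measurable_choice[OF i A], of "\<lambda>d. d = c" "count_space UNIV"] by simp
  show ?thesis by measurable
qed

lemma sum_indicator_eq:
  assumes "A0 \<in> feasible E"
  shows "(\<Sum>A\<in>feasible E. if A0 = A then f A else (0::real)) = f A0"
  using assms finite_feasible by simp

lemma gain_eq: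
  assumes k: "k < n" and v: "v \<in> space P"
  shows "gain k v = (\<Sum>A\<in>feasible E. \<Sum>x\<in>J (Suc k). (rprice A x - T A x) *
    indicator {v \<in> space P. sold k v = A \<and> ch (Suc k) A v = Some x} v)"
proof -
  have i: "Suc k \<in> {1..n}" and A0: "sold k v \<in> feasible E" using k sold_feasible[OF _ v] by auto
  have "(\<Sum>A\<in>feasible E. \<Sum>x\<in>J (Suc k). (rprice A x - T A x) *
      indicator {v \<in> space P. sold k v = A \<and> ch (Suc k) A v = Some x} v)
    = (\<Sum>A\<in>feasible E. if sold k v = A then
        (\<Sum>x\<in>J (Suc k). if ch (Suc k) A v = Some x then rprice A x - T A x else 0) else 0)"
    using v by (intro sum.cong refl) (auto simp: indicator_def intro!: sum.cong)
  also have "\<dots> = (\<Sum>x\<in>J (Suc k). if ch (Suc k) (sold k v) v = Some x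
      then rprice (sold k v) x - T (sold k v) x else 0)"
    by (rule sum_indicator_eq[OF A0])
  also have "\<dots> = gain k v"
  proof (cases "ch (Suc k) (sold k v) v")
    case (Some x)
    then show ?thesis using chosen(1)[OF i A0 v Some] finite_J[OF i] by (simp add: gain_def)
  qed (simp add: gain_def)
  finally show ?thesis ..
qed

lemma reserve_eq:
  assumes k: "k < n" and v: "v \<in> space P"
  shows "reserve k v = (\<Sum>A\<in>feasible E. \<Sum>x\<in>J (Suc k).
    (if insert x A \<in> feasible E then excess A x else 0) *
    indicator {v \<in> space P. sold k v = A \<and> ch (Suc k) A v = None} v)"
proof -
  have i: "Suc k \<in> {1..n}" and A0: "sold k v \<in> feasible E" using k sold_feasible[OF _ v] by auto
  have "(\<Sum>A\<in>feasible E. \<Sum>x\<in>J (Suc k). (if insert x A \<in> feasible E then excess A x else 0) *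
      indicator {v \<in> space P. sold k v = A \<and> ch (Suc k) A v = None} v)
    = (\<Sum>A\<in>feasible E. if sold k v = A then (if ch (Suc k) A v = None then
        (\<Sum>x\<in>J (Suc k). if insert x A \<in> feasible E then excess A x else 0) else 0) else 0)"
    using v by (intro sum.cong refl) (auto simp: indicator_def intro!: sum.cong)
  also have "\<dots> = (if ch (Suc k) (sold k v) v = None then
        (\<Sum>x\<in>J (Suc k). if insert x (sold k v) \<in> feasible E then excess (sold k v) x else 0) else 0)"
    by (rule sum_indicator_eq[OF A0])
  also have "\<dots> = reserve k v"
    unfolding reserve_def by (simp add: sum.inter_filter[OF finite_J[OF i]])
  finally show ?thesis ..
qed

text \<open>\<open>gain\<close> and \<open>reserve\<close> have this form, with events that fix the
  set sold and the choice made; their expectations become sums of probabilities that can be compared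
  term by term.\<close>

lemma integral_finite_combination:
  fixes c :: "'a \<Rightarrow> 'b \<Rightarrow> real"
  assumes S: "\<And>a b. a \<in> I \<Longrightarrow> b \<in> K \<Longrightarrow> S a b \<in> sets P"
    and g: "\<And>v. v \<in> space P \<Longrightarrow> g v = (\<Sum>a\<in>I. \<Sum>b\<in>K. c a b * indicator (S a b) v)"
  shows "integrable P g" "(\<integral>v. g v \<partial>P) = (\<Sum>a\<in>I. \<Sum>b\<in>K. c a b * prob (S a b))"
proof -
  have int: "integrable P (\<lambda>v. c a b * indicator (S a b) v)" if "a \<in> I" "b \<in> K" for a b
    using S[OF that] by (intro integrable_mult_right integrable_real_indicator) (auto simp: emeasure_eq_measure)
  have "integrable P (\<lambda>v. \<Sum>a\<in>I. \<Sum>b\<in>K. c a b * indicator (S a b) v)"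
    by (intro Bochner_Integration.integrable_sum int)
  then show "integrable P g"
    by (subst Bochner_Integration.integrable_cong[OF refl g]) simp_all
  have "(\<integral>v. g v \<partial>P) = (\<integral>v. (\<Sum>a\<in>I. \<Sum>b\<in>K. c a b * indicator (S a b) v) \<partial>P)"
    by (intro Bochner_Integration.integral_cong refl g)
  also have "\<dots> = (\<Sum>a\<in>I. \<Sum>b\<in>K. \<integral>v. c a b * indicator (S a b) v \<partial>P)"
    using int by (simp add: Bochner_Integration.integral_sum Bochner_Integration.integrable_sum)
  also have "\<dots> = (\<Sum>a\<in>I. \<Sum>b\<in>K. c a b * prob (S a b))"
    using S by (intro sum.cong refl) (simp add: integral_indicator Int_absorb1 sets.sets_into_space)
  finally show "(\<integral>v. g v \<partial>P) = (\<Sum>a\<in>I. \<Sum>b\<in>K. c a b * prob (S a b))" .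
qed

text \<open>Compared for each set \<open>A\<close> sold before and each service \<open>x\<close>:
  the excess is the margin \<open>r - T A x\<close> times the chance of a value above
  \<open>r\<close>, and \<open>sale_probability\<close> bounds that chance times the probability of
  buying nothing by the probability of selling \<open>x\<close>.\<close>

lemma reserve_le_gain:
  assumes k: "k < n"
  shows "integrable P (gain k)" "integrable P (reserve k)"
    "(\<integral>v. reserve k v \<partial>P) \<le> (\<integral>v. gain k v \<partial>P)"
proof -
  have i: "Suc k \<in> {1..n}" using k by simp
  have g: "integrable P (gain k)"
      "(\<integral>v. gain k v \<partial>P) = (\<Sum>A\<in>feasible E. \<Sum>x\<in>J (Suc k). (rprice A x - T A x) *
        prob {v \<in> space P. sold k v = A \<and> ch (Suc k) A v = Some x})"
    by (rule integral_finite_combination, erule sets_choice[OF k], erule gain_eq[OF k])+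
  have r: "integrable P (reserve k)"
      "(\<integral>v. reserve k v \<partial>P) = (\<Sum>A\<in>feasible E. \<Sum>x\<in>J (Suc k).
        (if insert x A \<in> feasible E then excess A x else 0) *
        prob {v \<in> space P. sold k v = A \<and> ch (Suc k) A v = None})"
    by (rule integral_finite_combination, erule sets_choice[OF k], erule reserve_eq[OF k])+
  show "integrable P (gain k)" "integrable P (reserve k)" by (rule g(1), rule r(1))
  show "(\<integral>v. reserve k v \<partial>P) \<le> (\<integral>v. gain k v \<partial>P)"
    unfolding g(2) r(2)
  proof (intro sum_mono)
    fix A x assume A: "A \<in> feasible E" and x: "x \<in> J (Suc k)"
    have xU: "x \<in> U" using x J_subset[OF i] by auto
    show "(if insert x A \<in> feasible E then excess A x else 0)
          * prob {v \<in> space P. sold k v = A \<and> ch (Suc k) A v = None}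
        \<le> (rprice A x - T A x) * prob {v \<in> space P. sold k v = A \<and> ch (Suc k) A v = Some x}"
    proof (rule price_cases[OF xU, of A])
      \<comment> \<open>Here \<open>rprice A x\<close> is 0, since \<open>real_of_ereal\<close>
        sends infinity to 0, and the margin may be negative; but \<open>x\<close> is never chosen,
        so its probability is 0.\<close>
      assume inf: "price A x = \<infinity>" and ex: "insert x A \<in> feasible E \<Longrightarrow> excess A x = 0"
      have "ch (Suc k) A v \<noteq> Some x" if "v \<in> space P" for v
        using chosen(4)[OF i A that, of x] inf by auto
      then have none: "{v \<in> space P. sold k v = A \<and> ch (Suc k) A v = Some x} = {}" by blast
      show ?thesis unfolding none using ex by simp
    next
      fix r assume r: "insert x A \<in> feasible E" "price A x = ereal r" "T A x \<le> r"
        "excess A x = (r - T A x) * measure (D x) {r<..}"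
      from mult_left_mono[OF sale_probability[OF k A x r(2)], of "r - T A x"] r
      show ?thesis by (simp add: mult.assoc mult.left_commute mult.commute)
    qed
  qed
qed

text \<open>The addable services are grouped by bidder. For a bidder who bought nothing, the
  thresholds have only grown since, so the excess was at least as large at that time. A bidder who
  bought has no addable service left, by unit demand.\<close>

lemma sum_reserve_ge:
  assumes v: "v \<in> space P"
  shows "(\<Sum>x\<in>addable (sold n v). excess (sold n v) x) \<le> (\<Sum>k<n. reserve k v)"
proof -
  let ?A = "sold n v"
  let ?g = "\<lambda>x. if x \<in> addable ?A then excess ?A x else 0"
  have AF: "?A \<in> feasible E" by (rule sold_feasible[OF order_refl v])
  have "(\<Sum>x\<in>addable ?A. excess ?A x) = (\<Sum>x\<in>U. ?g x)"
    using sum.inter_restrict[OF finite_U, of "excess ?A" "addable ?A"]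
    by (simp add: Int_absorb1 addable_def subset_iff)
  also have "\<dots> = (\<Sum>i=1..n. \<Sum>x\<in>J i. ?g x)" by (rule sum_bidders[symmetric])
  also have "\<dots> = (\<Sum>k<n. \<Sum>x\<in>J (Suc k). ?g x)" by (simp add: sum.atLeast1_atMost_eq)
  also have "\<dots> \<le> (\<Sum>k<n. reserve k v)"
  proof (rule sum_mono)
    fix k assume "k \<in> {..<n}"
    then have k: "k < n" and i: "Suc k \<in> {1..n}" by auto
    let ?a = "sold k v"
    have a: "?a \<in> feasible E" using k by (intro sold_feasible v) simp
    have sub: "?a \<subseteq> ?A" using k by (intro sold_mono) simp
    have fin: "finite (J (Suc k))" by (rule finite_J[OF i])
    show "(\<Sum>x\<in>J (Suc k). ?g x) \<le> reserve k v"
    proof (cases "ch (Suc k) ?a v")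
      case None
      have "(\<Sum>x\<in>J (Suc k). ?g x) \<le> (\<Sum>x\<in>J (Suc k). if insert x ?a \<in> feasible E then excess ?a x else 0)"
      proof (rule sum_mono)
        fix x assume "x \<in> J (Suc k)"
        show "?g x \<le> (if insert x ?a \<in> feasible E then excess ?a x else 0)"
        proof (cases "x \<in> addable ?A")
          case True
          then have x: "x \<in> U" "x \<notin> ?A" "insert x ?A \<in> feasible E" by (auto simp: addable_def)
          have "insert x ?a \<in> feasible E" by (rule feasible_subset[OF x(3)]) (use sub in auto)
          moreover have "excess ?A x \<le> excess ?a x"
            by (rule excess_antimono[OF x(1) threshold_mono[OF x(3) sub x(2)]])
          ultimately show ?thesis using True by simp
        qed (simp add: excess_nonneg)
      qed
      also have "\<dots> = reserve k v" unfolding reserve_def using None by (simp add: sum.inter_filter[OF fin])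
      finally show ?thesis .
    next
      case (Some y)
      note cy = chosen[OF i a v Some]
      have "y \<in> sold (Suc k) v" unfolding sold_Suc using Some by simp
      then have yA: "y \<in> ?A" using sold_mono[of "Suc k" n v] k by auto
      have "?g x = 0" if x: "x \<in> J (Suc k)" for x
      proof (rule ccontr)
        assume "?g x \<noteq> 0"
        then have xa: "x \<notin> ?A" "insert x ?A \<in> feasible E" by (auto simp: addable_def split: if_splits)
        have "card {x, y} \<le> card (insert x ?A \<inter> J (Suc k))"
          using x yA cy(1) fin by (intro card_mono) auto
        moreover have "x \<noteq> y" using xa(1) yA by blast
        then have "card {x, y} = 2" by simp
        ultimately show False using unit_demand[OF xa(2) i] by simp
      qed
      then have "(\<Sum>x\<in>J (Suc k). ?g x) = 0" by (intro sum.neutral) blast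
      then show ?thesis using Some by (simp add: reserve_def)
    qed
  qed
  finally show ?thesis .
qed

section \<open>Combination of the two lower bounds\<close>

lemma posted_revenue_ge: "opt_weight / (4 * real p - 2) \<le> posted_revenue E B ch"
proof -
  let ?q = "real p"
  define C where "C = (\<integral>v. deficit (sold n v) \<partial>P)"
  define G where "G = (\<Sum>k<n. \<integral>v. gain k v \<partial>P)"
  have q: "1 \<le> ?q" using p_pos by simp
  have intg: "integrable P (gain k)" and intr: "integrable P (reserve k)"
    and rg: "(\<integral>v. reserve k v \<partial>P) \<le> (\<integral>v. gain k v \<partial>P)" if "k \<in> {..<n}" for k
    using reserve_le_gain[of k] that by auto
  have intC: "integrable P (\<lambda>v. deficit (sold n v))"
  proof (rule integrable_const_bound)
    show "AE v in P. norm (deficit (sold n v)) \<le> (\<Sum>A\<in>feasible E. \<bar>deficit A\<bar>)"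
      by (rule AE_I2) (use member_le_sum[OF sold_feasible[OF order_refl] _ finite_feasible,
          of _ "\<lambda>A. \<bar>deficit A\<bar>"] in auto)
    show "(\<lambda>v. deficit (sold n v)) \<in> borel_measurable P"
      using measurable_compose[OF measurable_sold[OF order_refl], of deficit borel] by simp
  qed
  have "posted_revenue E B ch = (\<integral>v. deficit (sold n v) / (2 * ?q) + (\<Sum>k<n. gain k v) \<partial>P)"
    unfolding posted_revenue_def by (intro Bochner_Integration.integral_cong refl payments_eq order_refl)
  also have "\<dots> = (\<integral>v. deficit (sold n v) / (2 * ?q) \<partial>P) + (\<integral>v. (\<Sum>k<n. gain k v) \<partial>P)"
    using intC intg by (intro Bochner_Integration.integral_add) auto
  also have "(\<integral>v. deficit (sold n v) / (2 * ?q) \<partial>P) = C / (2 * ?q)" unfolding C_def by simp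
  also have "(\<integral>v. (\<Sum>k<n. gain k v) \<partial>P) = G"
    unfolding G_def by (rule Bochner_Integration.integral_sum) (rule intg)
  finally have rev: "posted_revenue E B ch = C / (2 * ?q) + G" .
  have G0: "0 \<le> G" unfolding G_def by (intro sum_nonneg Bochner_Integration.integral_nonneg gain_nonneg) auto
  have "opt_weight / 2 - C * (1 - 1 / (2 * ?q))
      = (\<integral>v. opt_weight / 2 - deficit (sold n v) * (1 - 1 / (2 * ?q)) \<partial>P)"
    unfolding C_def using intC by (simp add: prob_space)
  also have "\<dots> \<le> (\<integral>v. (\<Sum>k<n. reserve k v) \<partial>P)"
  proof (rule integral_mono)
    fix v assume v: "v \<in> space P"
    show "opt_weight / 2 - deficit (sold n v) * (1 - 1 / (2 * ?q)) \<le> (\<Sum>k<n. reserve k v)"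
      by (rule order_trans[OF sum_excess_ge[OF sold_feasible[OF order_refl v]] sum_reserve_ge[OF v]])
  qed (use intC intr in auto)
  also have "\<dots> = (\<Sum>k<n. \<integral>v. reserve k v \<partial>P)"
    by (rule Bochner_Integration.integral_sum) (rule intr)
  also have "\<dots> \<le> G" unfolding G_def by (rule sum_mono) (rule rg)
  finally have G1: "opt_weight / 2 - C * (1 - 1 / (2 * ?q)) \<le> G" .
  \<comment> \<open>The revenue \<open>C / (2 * ?q) + G\<close> times \<open>4 * ?q - 2\<close>
    splits into \<open>C * (2 - 1 / ?q)\<close>, \<open>2 * G\<close> and
    \<open>(4 * ?q - 4) * G\<close>. The first two together reach \<open>opt_weight\<close> by
    \<open>G1\<close>, and the third is nonnegative.\<close>
  have "opt_weight - C * (2 - 1 / ?q) \<le> 2 * G" using G1 q by (simp add: field_simps)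
  moreover have "0 \<le> (4 * ?q - 4) * G" using G0 q by (intro mult_nonneg_nonneg) auto
  moreover have "(4 * ?q - 2) * (C / (2 * ?q)) = C * (2 - 1 / ?q)" using q by (simp add: field_simps)
  ultimately have "opt_weight \<le> (4 * ?q - 2) * (C / (2 * ?q) + G)" by (simp add: algebra_simps)
  then show ?thesis using q unfolding rev by (simp add: pos_divide_le_eq mult.commute)
qed

end

theorem theorem1:
  fixes E :: "'u bmumd"
    and B :: "('u \<Rightarrow> real) \<Rightarrow> 'u set"
    and ch :: "nat \<Rightarrow> 'u set \<Rightarrow> ('u \<Rightarrow> real) \<Rightarrow> 'u option"
  assumes "bmumd_setting E"
    and "max_weight_selection E B"
    and "choice_rule E B ch"
  shows "ereal (1 / (4 * real (num_mat E) - 2)) * optimal_revenue E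
           \<le> ereal (posted_revenue E B ch)
       \<and> (num_mat E = 1 \<longrightarrow> ereal (1 / 2) * optimal_revenue E \<le> ereal (posted_revenue E B ch))"
proof -
  interpret bmumd_choice E B ch by standard (rule assms)+
  have "0 \<le> 1 / (4 * real p - 2)" using p_pos by simp
  then have "ereal (1 / (4 * real p - 2)) * optimal_revenue E
      \<le> ereal (1 / (4 * real p - 2)) * ereal opt_weight"
    by (intro ereal_mult_left_mono optimal_revenue_le) simp
  also have "\<dots> \<le> ereal (posted_revenue E B ch)" using posted_revenue_ge by simp
  finally have "ereal (1 / (4 * real p - 2)) * optimal_revenue E \<le> ereal (posted_revenue E B ch)" .
  then show ?thesis by auto
qed

end
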